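(* Let $\mathcal{M}$ be a preadditive monoidal category with equalizers. Assume that the tensor functors are additive and preserve equalizers. For any $\mathbb{A}=(A,m_A,u_A,\Delta_A,\varepsilon_A,c_A)\in\mathrm{BrBialg}_{\mathcal{M}}$ there is a unique morphism $c_{P(\mathbb{A})}:P(\mathbb{A})\otimes P(\mathbb{A})\to P(\mathbb{A})\otimes P(\mathbb{A})$ such that $$(\xi\mathbb{A}\otimes\xi\mathbb{A})\circ c_{P(\mathbb{A})}=c_A\circ(\xi\mathbb{A}\otimes\xi\mathbb{A}).$$ We have that $(P(\mathbb{A}),c_{P(\mathbb{A})})\in\mathrm{Br}_{\mathcal{M}}$ and that $\xi\mathbb{A}:P(\mathbb{A})\to A$ is a morphism of braided objects $(P(\mathbb{A}),c_{P(\mathbb{A})})\to(A,c_A)$. For any morphism $f:\mathbb{A}\to\mathbb{A}'$ in $\mathrm{BrBialg}_{\mathcal{M}}$ there is a unique morphism $P(f):P(\mathbb{A})\to P(\mathbb{A}')$ such that $$\xi\mathbb{A}'\circ P(f)=f\circ\xi\mathbb{A},$$ and $P(f)$ is a morphism of braided objects. In this way we get a functor $$P_{\mathrm{Br}}:\mathrm{BrBialg}_{\mathcal{M}}\to\mathrm{Br}_{\mathcal{M}},\quad \mathbb{A}\mapsto(P(\mathbb{A}),c_{P(\mathbb{A})}),\quad f\mapsto P(f).$$ Moreover $\xi\mathbb{A}'\circ P_{\mathrm{Br}}(f)=\Omega_{\mathrm{Br}}\mho_{\mathrm{Br}}(f)\circ\xi\mathbb{A}$ for every morphism $f:\mathbb{A}\to\mathbb{A}'$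 in $\mathrm{BrBialg}_{\mathcal{M}}$, i.e. $\xi\mathbb{A}:P_{\mathrm{Br}}\mathbb{A}\to\Omega_{\mathrm{Br}}\mho_{\mathrm{Br}}\mathbb{A}$ is natural in $\mathbb{A}$.
   Context: Associativity constraints of the monoidal category $(\mathcal M,\otimes,\mathbf 1,a,l,r)$ are suppressed in formulas; $l_X:\mathbf 1\otimes X\to X$, $r_X:X\otimes\mathbf 1\to X$; an object also denotes its identity morphism. The tensor functors are $M\otimes(-)$ and $(-)\otimes M$ for all objects $M$. Put $\Delta_{\mathbf 1}=l_{\mathbf 1}^{-1}=r_{\mathbf 1}^{-1}$ and $m_{\mathbf 1}=l_{\mathbf 1}=r_{\mathbf 1}$. A braided object is a pair $(V,c)$ with $c:V\otimes V\to V\otimes V$ invertible such that $(c\otimes V)(V\otimes c)(c\otimes V)=(V\otimes c)(c\otimes V)(V\otimes c)$; a morphism $(V,c_V)\to(W,c_W)$ is $f:V\to W$ with $c_W(f\otimes f)=(f\otimes f)c_V$. These form $\mathrm{Br}_{\mathcal M}$. A braided algebra is $(A,m,u,c)$ with $(A,m,u)$ an algebra in $\mathcal M$, $(A,c)$ a braided object, and $c(m\otimes A)=(A\otimes m)(c\otimes A)(A\otimes c)$, $c(A\otimes m)=(m\otimes A)(A\otimes c)(c\otimes A)$, $c(u\otimes A)l_A^{-1}=(A\otimes u)r_A^{-1}$, $c(A\otimes u)r_A^{-1}=(u\otimes A)l_A^{-1}$ (category $\mathrm{BrAlg}_{\mathcal M}$; morphisms are algebra morphisms that are morphisms of braided objects).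 A braided coalgebra is $(C,\Delta,\varepsilon,c)$ with $(C,\Delta,\varepsilon)$ a coalgebra, $(C,c)$ a braided object, and $(\Delta\otimes C)c=(C\otimes c)(c\otimes C)(C\otimes\Delta)$, $(C\otimes\Delta)c=(c\otimes C)(C\otimes c)(\Delta\otimes C)$, $l_C(\varepsilon\otimes C)c=r_C(C\otimes\varepsilon)$, $r_C(C\otimes\varepsilon)c=l_C(\varepsilon\otimes C)$ (morphisms: coalgebra morphisms that are morphisms of braided objects). A braided bialgebra is $(B,m,u,\Delta,\varepsilon,c)$ with $(B,m,u,c)$ a braided algebra, $(B,\Delta,\varepsilon,c)$ a braided coalgebra, and $\Delta m=(m\otimes m)(B\otimes c\otimes B)(\Delta\otimes\Delta)$, $\Delta u=(u\otimes u)\Delta_{\mathbf 1}$, $\varepsilon m=m_{\mathbf 1}(\varepsilon\otimes\varepsilon)$, $\varepsilon u=\mathrm{Id}_{\mathbf 1}$. Morphisms are morphisms of both braided algebras and braided coalgebras; category $\mathrm{BrBialg}_{\mathcal M}$. For $\mathbb A=(A,m_A,u_A,\Delta_A,\varepsilon_A,c_A)\in\mathrm{BrBialg}_{\mathcal M}$, $\xi\mathbb A:P(\mathbb A)\to A$ denotes a chosen equalizer in $\mathcal M$ of the pair $\Delta_A,\ (A\otimes u_A)r_A^{-1}+(u_A\otimes A)l_A^{-1}:A\to A\otimes A$. $\mho_{\mathrm{Br}}:\mathrm{BrBialg}_{\mathcal M}\to\mathrm{BrAlg}_{\mathcal M}$ and $\Omega_{\mathrm{Br}}:\mathrm{BrAlg}_{\mathcal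 M}\to\mathrm{Br}_{\mathcal M}$ are the forgetful functors. *)

theory Defs
  imports "HOL-Algebra.Group"
begin

section \<open>Categories\<close>

text \<open>Composition is written in the usual order and is only meaningful on composable arrows.\<close>

record ('o, 'm) category =
  Obj :: "'o set"
  Arr :: "'m set"
  Dom :: "'m \<Rightarrow> 'o"
  Cod :: "'m \<Rightarrow> 'o"
  Ident :: "'o \<Rightarrow> 'm" (\<open>\<iota>\<index>\<close>)
  Comp :: "'m \<Rightarrow> 'm \<Rightarrow> 'm" (infixr \<open>\<cdot>\<index>\<close> 55)

definition Hom :: "('o, 'm, 'x) category_scheme \<Rightarrow> 'o \<Rightarrow> 'o \<Rightarrow> 'm set" where
  "Hom C X Y = {f \<in> Arr C. Dom C f = X \<and> Cod C f = Y}"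

locale category =
  fixes C :: "('o, 'm, 'x) category_scheme" (structure)
  assumes Dom_in_Obj: "f \<in> Arr C \<Longrightarrow> Dom C f \<in> Obj C"
    and Cod_in_Obj: "f \<in> Arr C \<Longrightarrow> Cod C f \<in> Obj C"
    and Ident_in_Hom: "X \<in> Obj C \<Longrightarrow> \<iota> X \<in> Hom C X X"
    and Comp_in_Hom: "\<lbrakk>f \<in> Hom C X Y; g \<in> Hom C Y Z\<rbrakk> \<Longrightarrow> g \<cdot> f \<in> Hom C X Z"
    and Comp_Ident_left: "f \<in> Hom C X Y \<Longrightarrow> \<iota> Y \<cdot> f = f"
    and Comp_Ident_right: "f \<in> Hom C X Y \<Longrightarrow> f \<cdot> \<iota> X = f"
    and Comp_assoc: "\<lbrakk>f \<in> Hom C W X; g \<in> Hom C X Y; h \<in> Hom C Y Z\<rbrakk>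
                       \<Longrightarrow> (h \<cdot> g) \<cdot> f = h \<cdot> (g \<cdot> f)"

definition inverse_arrows :: "('o, 'm, 'x) category_scheme \<Rightarrow> 'm \<Rightarrow> 'm \<Rightarrow> bool" where
  "inverse_arrows C f g \<longleftrightarrow>
     f \<in> Arr C \<and> g \<in> Hom C (Cod C f) (Dom C f) \<and>
     g \<cdot>\<^bsub>C\<^esub> f = \<iota>\<^bsub>C\<^esub> (Dom C f) \<and> f \<cdot>\<^bsub>C\<^esub> g = \<iota>\<^bsub>C\<^esub> (Cod C f)"

definition is_iso :: "('o, 'm, 'x) category_scheme \<Rightarrow> 'm \<Rightarrow> bool" where
  "is_iso C f \<longleftrightarrow> (\<exists>g. inverse_arrows C f g)"

definition Inv :: "('o, 'm, 'x) category_scheme \<Rightarrow> 'm \<Rightarrow> 'm" where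
  "Inv C f = (THE g. inverse_arrows C f g)"

definition is_equalizer ::
    "('o, 'm, 'x) category_scheme \<Rightarrow> 'm \<Rightarrow> 'm \<Rightarrow> 'o \<Rightarrow> 'm \<Rightarrow> bool" where
  "is_equalizer C f g E e \<longleftrightarrow>
     (\<exists>X Y. f \<in> Hom C X Y \<and> g \<in> Hom C X Y \<and> e \<in> Hom C E X \<and>
        f \<cdot>\<^bsub>C\<^esub> e = g \<cdot>\<^bsub>C\<^esub> e \<and>
        (\<forall>Z h. h \<in> Hom C Z X \<and> f \<cdot>\<^bsub>C\<^esub> h = g \<cdot>\<^bsub>C\<^esub> h \<longrightarrow>
           (\<exists>!k. k \<in> Hom C Z E \<and> e \<cdot>\<^bsub>C\<^esub> k = h)))"

definition has_equalizers :: "('o, 'm, 'x) category_scheme \<Rightarrow> bool" where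
  "has_equalizers C \<longleftrightarrow>
     (\<forall>X Y f g. f \<in> Hom C X Y \<and> g \<in> Hom C X Y \<longrightarrow> (\<exists>E e. is_equalizer C f g E e))"

record ('o, 'm, 'p, 'n) functor_data =
  on_obj :: "'o \<Rightarrow> 'p"
  on_arr :: "'m \<Rightarrow> 'n"

locale cat_functor = C: category C + D: category D
  for C :: "('o, 'm, 'x) category_scheme"
    and D :: "('p, 'n, 'y) category_scheme" +
  fixes F :: "('o, 'm, 'p, 'n) functor_data"
  assumes on_obj_in_Obj: "X \<in> Obj C \<Longrightarrow> on_obj F X \<in> Obj D"
    and on_arr_in_Hom:
      "f \<in> Hom C X Y \<Longrightarrow> on_arr F f \<in> Hom D (on_obj F X) (on_obj F Y)"
    and on_arr_Ident: "X \<in> Obj C \<Longrightarrow> on_arr F (\<iota>\<^bsub>C\<^esub> X) = \<iota>\<^bsub>D\<^esub> (on_obj F X)"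
    and on_arr_Comp:
      "\<lbrakk>f \<in> Hom C X Y; g \<in> Hom C Y Z\<rbrakk>
         \<Longrightarrow> on_arr F (g \<cdot>\<^bsub>C\<^esub> f) = on_arr F g \<cdot>\<^bsub>D\<^esub> on_arr F f"

definition functor_comp ::
    "('p, 'n, 'q, 'k) functor_data \<Rightarrow> ('o, 'm, 'p, 'n) functor_data
       \<Rightarrow> ('o, 'm, 'q, 'k) functor_data" where
  "functor_comp G F =
     \<lparr>on_obj = \<lambda>X. on_obj G (on_obj F X), on_arr = \<lambda>f. on_arr G (on_arr F f)\<rparr>"

definition preserves_equalizers ::
    "('o, 'm, 'x) category_scheme \<Rightarrow> ('p, 'n, 'y) category_scheme
       \<Rightarrow> ('o, 'm, 'p, 'n) functor_data \<Rightarrow> bool" where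
  "preserves_equalizers C D F \<longleftrightarrow>
     (\<forall>f g E e. is_equalizer C f g E e \<longrightarrow>
        is_equalizer D (on_arr F f) (on_arr F g) (on_obj F E) (on_arr F e))"

locale natural_transformation = F: cat_functor C D F + G: cat_functor C D G
  for C :: "('o, 'm, 'x) category_scheme"
    and D :: "('p, 'n, 'y) category_scheme"
    and F :: "('o, 'm, 'p, 'n) functor_data"
    and G :: "('o, 'm, 'p, 'n) functor_data" +
  fixes \<tau> :: "'o \<Rightarrow> 'n"
  assumes component_in_Hom: "X \<in> Obj C \<Longrightarrow> \<tau> X \<in> Hom D (on_obj F X) (on_obj G X)"
    and naturality:
      "f \<in> Hom C X Y \<Longrightarrow> \<tau> Y \<cdot>\<^bsub>D\<^esub> on_arr F f = on_arr G f \<cdot>\<^bsub>D\<^esub> \<tau> X"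


section \<open>Preadditive monoidal categories\<close>

text \<open>
  The tensor product is written \<open>\<boxdot>\<close> on objects and \<open>\<boxtimes>\<close> on arrows.
  The category is not assumed strict: the associativity constraint is
  \<open>\<a> X Y Z : (X \<boxdot> Y) \<boxdot> Z \<rightarrow> X \<boxdot> (Y \<boxdot> Z)\<close>.
\<close>

record ('o, 'm) monoidal_category = "('o, 'm) category" +
  Ten_obj :: "'o \<Rightarrow> 'o \<Rightarrow> 'o" (infixl \<open>\<boxdot>\<index>\<close> 70)
  Ten_arr :: "'m \<Rightarrow> 'm \<Rightarrow> 'm" (infixl \<open>\<boxtimes>\<index>\<close> 70)
  Unit_obj :: "'o" (\<open>\<I>\<index>\<close>)
  Assoc :: "'o \<Rightarrow> 'o \<Rightarrow> 'o \<Rightarrow> 'm" (\<open>\<a>\<index>\<close>)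
  Lunit :: "'o \<Rightarrow> 'm" (\<open>\<l>\<index>\<close>)
  Runit :: "'o \<Rightarrow> 'm" (\<open>\<r>\<index>\<close>)

locale monoidal_category = category M
  for M :: "('o, 'm, 'x) monoidal_category_scheme" (structure) +
  assumes Ten_in_Obj: "\<lbrakk>X \<in> Obj M; Y \<in> Obj M\<rbrakk> \<Longrightarrow> X \<boxdot> Y \<in> Obj M"
    and Ten_in_Hom: "\<lbrakk>f \<in> Hom M X X'; g \<in> Hom M Y Y'\<rbrakk>
                       \<Longrightarrow> f \<boxtimes> g \<in> Hom M (X \<boxdot> Y) (X' \<boxdot> Y')"
    and Ten_Ident: "\<lbrakk>X \<in> Obj M; Y \<in> Obj M\<rbrakk> \<Longrightarrow> \<iota> X \<boxtimes> \<iota> Y = \<iota> (X \<boxdot> Y)"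
    and Ten_Comp: "\<lbrakk>f \<in> Hom M X X'; f' \<in> Hom M X' X''; g \<in> Hom M Y Y'; g' \<in> Hom M Y' Y''\<rbrakk>
                     \<Longrightarrow> (f' \<cdot> f) \<boxtimes> (g' \<cdot> g) = (f' \<boxtimes> g') \<cdot> (f \<boxtimes> g)"
    and Unit_in_Obj: "\<I> \<in> Obj M"
    and Assoc_in_Hom: "\<lbrakk>X \<in> Obj M; Y \<in> Obj M; Z \<in> Obj M\<rbrakk>
                         \<Longrightarrow> \<a> X Y Z \<in> Hom M ((X \<boxdot> Y) \<boxdot> Z) (X \<boxdot> (Y \<boxdot> Z))"
    and Assoc_iso: "\<lbrakk>X \<in> Obj M; Y \<in> Obj M; Z \<in> Obj M\<rbrakk> \<Longrightarrow> is_iso M (\<a> X Y Z)"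
    and Assoc_natural: "\<lbrakk>f \<in> Hom M X X'; g \<in> Hom M Y Y'; h \<in> Hom M Z Z'\<rbrakk>
                          \<Longrightarrow> \<a> X' Y' Z' \<cdot> ((f \<boxtimes> g) \<boxtimes> h) = (f \<boxtimes> (g \<boxtimes> h)) \<cdot> \<a> X Y Z"
    and Lunit_in_Hom: "X \<in> Obj M \<Longrightarrow> \<l> X \<in> Hom M (\<I> \<boxdot> X) X"
    and Lunit_iso: "X \<in> Obj M \<Longrightarrow> is_iso M (\<l> X)"
    and Lunit_natural: "f \<in> Hom M X Y \<Longrightarrow> \<l> Y \<cdot> (\<iota> \<I> \<boxtimes> f) = f \<cdot> \<l> X"
    and Runit_in_Hom: "X \<in> Obj M \<Longrightarrow> \<r> X \<in> Hom M (X \<boxdot> \<I>) X"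
    and Runit_iso: "X \<in> Obj M \<Longrightarrow> is_iso M (\<r> X)"
    and Runit_natural: "f \<in> Hom M X Y \<Longrightarrow> \<r> Y \<cdot> (f \<boxtimes> \<iota> \<I>) = f \<cdot> \<r> X"
    and pentagon: "\<lbrakk>W \<in> Obj M; X \<in> Obj M; Y \<in> Obj M; Z \<in> Obj M\<rbrakk>
                     \<Longrightarrow> (\<iota> W \<boxtimes> \<a> X Y Z) \<cdot> \<a> W (X \<boxdot> Y) Z \<cdot> (\<a> W X Y \<boxtimes> \<iota> Z)
                         = \<a> W X (Y \<boxdot> Z) \<cdot> \<a> (W \<boxdot> X) Y Z"
    and triangle: "\<lbrakk>X \<in> Obj M; Y \<in> Obj M\<rbrakk>
                     \<Longrightarrow> (\<iota> X \<boxtimes> \<l> Y) \<cdot> \<a> X \<I> Y = \<r> X \<boxtimes> \<iota> Y"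

record ('o, 'm) preadditive_monoidal_category = "('o, 'm) monoidal_category" +
  Plus :: "'m \<Rightarrow> 'm \<Rightarrow> 'm" (infixl \<open>\<boxplus>\<index>\<close> 65)
  Zero :: "'o \<Rightarrow> 'o \<Rightarrow> 'm"

definition Hom_group ::
    "('o, 'm, 'x) preadditive_monoidal_category_scheme \<Rightarrow> 'o \<Rightarrow> 'o \<Rightarrow> 'm monoid" where
  "Hom_group M X Y = \<lparr>carrier = Hom M X Y, monoid.mult = Plus M, one = Zero M X Y\<rparr>"

locale preadditive_monoidal_category = monoidal_category M
  for M :: "('o, 'm, 'x) preadditive_monoidal_category_scheme" (structure) +
  assumes Hom_comm_group: "\<lbrakk>X \<in> Obj M; Y \<in> Obj M\<rbrakk> \<Longrightarrow> comm_group (Hom_group M X Y)"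
    and Comp_additive_right:
      "\<lbrakk>g \<in> Hom M Y Z; X \<in> Obj M\<rbrakk> \<Longrightarrow> (\<lambda>f. g \<cdot> f) \<in> hom (Hom_group M X Y) (Hom_group M X Z)"
    and Comp_additive_left:
      "\<lbrakk>f \<in> Hom M X Y; Z \<in> Obj M\<rbrakk> \<Longrightarrow> (\<lambda>g. g \<cdot> f) \<in> hom (Hom_group M Y Z) (Hom_group M X Z)"

definition additive_functor ::
    "('o, 'm, 'x) preadditive_monoidal_category_scheme
       \<Rightarrow> ('p, 'n, 'y) preadditive_monoidal_category_scheme
       \<Rightarrow> ('o, 'm, 'p, 'n) functor_data \<Rightarrow> bool" where
  "additive_functor M N F \<longleftrightarrow>
     (\<forall>X\<in>Obj M. \<forall>Y\<in>Obj M.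
        on_arr F \<in> hom (Hom_group M X Y) (Hom_group N (on_obj F X) (on_obj F Y)))"

definition left_tensor_functor ::
    "('o, 'm, 'x) monoidal_category_scheme \<Rightarrow> 'o \<Rightarrow> ('o, 'm, 'o, 'm) functor_data" where
  "left_tensor_functor M X =
     \<lparr>on_obj = \<lambda>Y. X \<boxdot>\<^bsub>M\<^esub> Y, on_arr = \<lambda>f. \<iota>\<^bsub>M\<^esub> X \<boxtimes>\<^bsub>M\<^esub> f\<rparr>"

definition right_tensor_functor ::
    "('o, 'm, 'x) monoidal_category_scheme \<Rightarrow> 'o \<Rightarrow> ('o, 'm, 'o, 'm) functor_data" where
  "right_tensor_functor M X =
     \<lparr>on_obj = \<lambda>Y. Y \<boxdot>\<^bsub>M\<^esub> X, on_arr = \<lambda>f. f \<boxtimes>\<^bsub>M\<^esub> \<iota>\<^bsub>M\<^esub> X\<rparr>"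


section \<open>Braided objects, algebras, coalgebras and bialgebras\<close>

text \<open>
  The associativity constraints that are usually suppressed are inserted explicitly.
  Threefold tensor powers are bracketed to the left, so \<open>c \<otimes> V\<close> is
  \<open>braid12\<close> and \<open>V \<otimes> c\<close> is \<open>braid23\<close>, both endomorphisms of \<open>(V \<boxdot> V) \<boxdot> V\<close>;
  \<open>braid_mid\<close> is \<open>V \<otimes> c \<otimes> V\<close> on \<open>(V \<boxdot> V) \<boxdot> (V \<boxdot> V)\<close>.
\<close>

definition braid12 :: "('o, 'm, 'x) monoidal_category_scheme \<Rightarrow> 'o \<Rightarrow> 'm \<Rightarrow> 'm" where
  "braid12 M V c = c \<boxtimes>\<^bsub>M\<^esub> \<iota>\<^bsub>M\<^esub> V"

definition braid23 :: "('o, 'm, 'x) monoidal_category_scheme \<Rightarrow> 'o \<Rightarrow> 'm \<Rightarrow> 'm" where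
  "braid23 M V c =
     Inv M (\<a>\<^bsub>M\<^esub> V V V) \<cdot>\<^bsub>M\<^esub> (\<iota>\<^bsub>M\<^esub> V \<boxtimes>\<^bsub>M\<^esub> c) \<cdot>\<^bsub>M\<^esub> \<a>\<^bsub>M\<^esub> V V V"

definition braid_mid :: "('o, 'm, 'x) monoidal_category_scheme \<Rightarrow> 'o \<Rightarrow> 'm \<Rightarrow> 'm" where
  "braid_mid M V c =
     Inv M (\<a>\<^bsub>M\<^esub> V V (V \<boxdot>\<^bsub>M\<^esub> V))
     \<cdot>\<^bsub>M\<^esub> (\<iota>\<^bsub>M\<^esub> V \<boxtimes>\<^bsub>M\<^esub>
          (\<a>\<^bsub>M\<^esub> V V V \<cdot>\<^bsub>M\<^esub> (c \<boxtimes>\<^bsub>M\<^esub> \<iota>\<^bsub>M\<^esub> V) \<cdot>\<^bsub>M\<^esub> Inv M (\<a>\<^bsub>M\<^esub> V V V)))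
     \<cdot>\<^bsub>M\<^esub> \<a>\<^bsub>M\<^esub> V V (V \<boxdot>\<^bsub>M\<^esub> V)"

definition braided_object ::
    "('o, 'm, 'x) monoidal_category_scheme \<Rightarrow> 'o \<Rightarrow> 'm \<Rightarrow> bool" where
  "braided_object M V c \<longleftrightarrow>
     V \<in> Obj M \<and> c \<in> Hom M (V \<boxdot>\<^bsub>M\<^esub> V) (V \<boxdot>\<^bsub>M\<^esub> V) \<and> is_iso M c \<and>
     braid12 M V c \<cdot>\<^bsub>M\<^esub> braid23 M V c \<cdot>\<^bsub>M\<^esub> braid12 M V c
       = braid23 M V c \<cdot>\<^bsub>M\<^esub> braid12 M V c \<cdot>\<^bsub>M\<^esub> braid23 M V c"

definition braided_object_morphism ::
    "('o, 'm, 'x) monoidal_category_scheme \<Rightarrow> 'o \<Rightarrow> 'm \<Rightarrow> 'o \<Rightarrow> 'm \<Rightarrow> 'm \<Rightarrow> bool" where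
  "braided_object_morphism M V c W d f \<longleftrightarrow>
     f \<in> Hom M V W \<and> d \<cdot>\<^bsub>M\<^esub> (f \<boxtimes>\<^bsub>M\<^esub> f) = (f \<boxtimes>\<^bsub>M\<^esub> f) \<cdot>\<^bsub>M\<^esub> c"

definition monoidal_algebra ::
    "('o, 'm, 'x) monoidal_category_scheme \<Rightarrow> 'o \<Rightarrow> 'm \<Rightarrow> 'm \<Rightarrow> bool" where
  "monoidal_algebra M A m u \<longleftrightarrow>
     A \<in> Obj M \<and> m \<in> Hom M (A \<boxdot>\<^bsub>M\<^esub> A) A \<and> u \<in> Hom M \<I>\<^bsub>M\<^esub> A \<and>
     m \<cdot>\<^bsub>M\<^esub> (m \<boxtimes>\<^bsub>M\<^esub> \<iota>\<^bsub>M\<^esub> A) = m \<cdot>\<^bsub>M\<^esub> (\<iota>\<^bsub>M\<^esub> A \<boxtimes>\<^bsub>M\<^esub> m) \<cdot>\<^bsub>M\<^esub> \<a>\<^bsub>M\<^esub> A A A \<and>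
     m \<cdot>\<^bsub>M\<^esub> (u \<boxtimes>\<^bsub>M\<^esub> \<iota>\<^bsub>M\<^esub> A) = \<l>\<^bsub>M\<^esub> A \<and>
     m \<cdot>\<^bsub>M\<^esub> (\<iota>\<^bsub>M\<^esub> A \<boxtimes>\<^bsub>M\<^esub> u) = \<r>\<^bsub>M\<^esub> A"

definition monoidal_algebra_morphism ::
    "('o, 'm, 'x) monoidal_category_scheme
       \<Rightarrow> 'o \<Rightarrow> 'm \<Rightarrow> 'm \<Rightarrow> 'o \<Rightarrow> 'm \<Rightarrow> 'm \<Rightarrow> 'm \<Rightarrow> bool" where
  "monoidal_algebra_morphism M A m u A' m' u' f \<longleftrightarrow>
     f \<in> Hom M A A' \<and> f \<cdot>\<^bsub>M\<^esub> m = m' \<cdot>\<^bsub>M\<^esub> (f \<boxtimes>\<^bsub>M\<^esub> f) \<and> f \<cdot>\<^bsub>M\<^esub> u = u'"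

definition monoidal_coalgebra ::
    "('o, 'm, 'x) monoidal_category_scheme \<Rightarrow> 'o \<Rightarrow> 'm \<Rightarrow> 'm \<Rightarrow> bool" where
  "monoidal_coalgebra M C \<Delta> \<epsilon> \<longleftrightarrow>
     C \<in> Obj M \<and> \<Delta> \<in> Hom M C (C \<boxdot>\<^bsub>M\<^esub> C) \<and> \<epsilon> \<in> Hom M C \<I>\<^bsub>M\<^esub> \<and>
     \<a>\<^bsub>M\<^esub> C C C \<cdot>\<^bsub>M\<^esub> (\<Delta> \<boxtimes>\<^bsub>M\<^esub> \<iota>\<^bsub>M\<^esub> C) \<cdot>\<^bsub>M\<^esub> \<Delta> = (\<iota>\<^bsub>M\<^esub> C \<boxtimes>\<^bsub>M\<^esub> \<Delta>) \<cdot>\<^bsub>M\<^esub> \<Delta> \<and>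
     \<l>\<^bsub>M\<^esub> C \<cdot>\<^bsub>M\<^esub> (\<epsilon> \<boxtimes>\<^bsub>M\<^esub> \<iota>\<^bsub>M\<^esub> C) \<cdot>\<^bsub>M\<^esub> \<Delta> = \<iota>\<^bsub>M\<^esub> C \<and>
     \<r>\<^bsub>M\<^esub> C \<cdot>\<^bsub>M\<^esub> (\<iota>\<^bsub>M\<^esub> C \<boxtimes>\<^bsub>M\<^esub> \<epsilon>) \<cdot>\<^bsub>M\<^esub> \<Delta> = \<iota>\<^bsub>M\<^esub> C"

definition monoidal_coalgebra_morphism ::
    "('o, 'm, 'x) monoidal_category_scheme
       \<Rightarrow> 'o \<Rightarrow> 'm \<Rightarrow> 'm \<Rightarrow> 'o \<Rightarrow> 'm \<Rightarrow> 'm \<Rightarrow> 'm \<Rightarrow> bool" where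
  "monoidal_coalgebra_morphism M C \<Delta> \<epsilon> C' \<Delta>' \<epsilon>' f \<longleftrightarrow>
     f \<in> Hom M C C' \<and> \<Delta>' \<cdot>\<^bsub>M\<^esub> f = (f \<boxtimes>\<^bsub>M\<^esub> f) \<cdot>\<^bsub>M\<^esub> \<Delta> \<and> \<epsilon>' \<cdot>\<^bsub>M\<^esub> f = \<epsilon>"

definition braided_algebra ::
    "('o, 'm, 'x) monoidal_category_scheme \<Rightarrow> 'o \<Rightarrow> 'm \<Rightarrow> 'm \<Rightarrow> 'm \<Rightarrow> bool" where
  "braided_algebra M A m u c \<longleftrightarrow>
     monoidal_algebra M A m u \<and> braided_object M A c \<and>
     c \<cdot>\<^bsub>M\<^esub> (m \<boxtimes>\<^bsub>M\<^esub> \<iota>\<^bsub>M\<^esub> A)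
       = (\<iota>\<^bsub>M\<^esub> A \<boxtimes>\<^bsub>M\<^esub> m) \<cdot>\<^bsub>M\<^esub> \<a>\<^bsub>M\<^esub> A A A \<cdot>\<^bsub>M\<^esub> braid12 M A c \<cdot>\<^bsub>M\<^esub> braid23 M A c \<and>
     c \<cdot>\<^bsub>M\<^esub> (\<iota>\<^bsub>M\<^esub> A \<boxtimes>\<^bsub>M\<^esub> m) \<cdot>\<^bsub>M\<^esub> \<a>\<^bsub>M\<^esub> A A A
       = (m \<boxtimes>\<^bsub>M\<^esub> \<iota>\<^bsub>M\<^esub> A) \<cdot>\<^bsub>M\<^esub> braid23 M A c \<cdot>\<^bsub>M\<^esub> braid12 M A c \<and>
     c \<cdot>\<^bsub>M\<^esub> (u \<boxtimes>\<^bsub>M\<^esub> \<iota>\<^bsub>M\<^esub> A) \<cdot>\<^bsub>M\<^esub> Inv M (\<l>\<^bsub>M\<^esub> A) = (\<iota>\<^bsub>M\<^esub> A \<boxtimes>\<^bsub>M\<^esub> u) \<cdot>\<^bsub>M\<^esub> Inv M (\<r>\<^bsub>M\<^esub> A) \<and>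
     c \<cdot>\<^bsub>M\<^esub> (\<iota>\<^bsub>M\<^esub> A \<boxtimes>\<^bsub>M\<^esub> u) \<cdot>\<^bsub>M\<^esub> Inv M (\<r>\<^bsub>M\<^esub> A) = (u \<boxtimes>\<^bsub>M\<^esub> \<iota>\<^bsub>M\<^esub> A) \<cdot>\<^bsub>M\<^esub> Inv M (\<l>\<^bsub>M\<^esub> A)"

definition braided_coalgebra ::
    "('o, 'm, 'x) monoidal_category_scheme \<Rightarrow> 'o \<Rightarrow> 'm \<Rightarrow> 'm \<Rightarrow> 'm \<Rightarrow> bool" where
  "braided_coalgebra M C \<Delta> \<epsilon> c \<longleftrightarrow>
     monoidal_coalgebra M C \<Delta> \<epsilon> \<and> braided_object M C c \<and>
     (\<Delta> \<boxtimes>\<^bsub>M\<^esub> \<iota>\<^bsub>M\<^esub> C) \<cdot>\<^bsub>M\<^esub> c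
       = braid23 M C c \<cdot>\<^bsub>M\<^esub> braid12 M C c \<cdot>\<^bsub>M\<^esub> Inv M (\<a>\<^bsub>M\<^esub> C C C) \<cdot>\<^bsub>M\<^esub> (\<iota>\<^bsub>M\<^esub> C \<boxtimes>\<^bsub>M\<^esub> \<Delta>) \<and>
     Inv M (\<a>\<^bsub>M\<^esub> C C C) \<cdot>\<^bsub>M\<^esub> (\<iota>\<^bsub>M\<^esub> C \<boxtimes>\<^bsub>M\<^esub> \<Delta>) \<cdot>\<^bsub>M\<^esub> c
       = braid12 M C c \<cdot>\<^bsub>M\<^esub> braid23 M C c \<cdot>\<^bsub>M\<^esub> (\<Delta> \<boxtimes>\<^bsub>M\<^esub> \<iota>\<^bsub>M\<^esub> C) \<and>
     \<l>\<^bsub>M\<^esub> C \<cdot>\<^bsub>M\<^esub> (\<epsilon> \<boxtimes>\<^bsub>M\<^esub> \<iota>\<^bsub>M\<^esub> C) \<cdot>\<^bsub>M\<^esub> c = \<r>\<^bsub>M\<^esub> C \<cdot>\<^bsub>M\<^esub> (\<iota>\<^bsub>M\<^esub> C \<boxtimes>\<^bsub>M\<^esub> \<epsilon>) \<and>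
     \<r>\<^bsub>M\<^esub> C \<cdot>\<^bsub>M\<^esub> (\<iota>\<^bsub>M\<^esub> C \<boxtimes>\<^bsub>M\<^esub> \<epsilon>) \<cdot>\<^bsub>M\<^esub> c = \<l>\<^bsub>M\<^esub> C \<cdot>\<^bsub>M\<^esub> (\<epsilon> \<boxtimes>\<^bsub>M\<^esub> \<iota>\<^bsub>M\<^esub> C)"

text \<open>The constraints \<open>\<l> \<I>\<close> and \<open>\<r> \<I>\<close> agree in every monoidal category;
  the structure of the unit object is written with \<open>\<l> \<I>\<close>.\<close>

definition braided_bialgebra ::
    "('o, 'm, 'x) monoidal_category_scheme
       \<Rightarrow> 'o \<Rightarrow> 'm \<Rightarrow> 'm \<Rightarrow> 'm \<Rightarrow> 'm \<Rightarrow> 'm \<Rightarrow> bool" where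
  "braided_bialgebra M B m u \<Delta> \<epsilon> c \<longleftrightarrow>
     braided_algebra M B m u c \<and> braided_coalgebra M B \<Delta> \<epsilon> c \<and>
     \<Delta> \<cdot>\<^bsub>M\<^esub> m = (m \<boxtimes>\<^bsub>M\<^esub> m) \<cdot>\<^bsub>M\<^esub> braid_mid M B c \<cdot>\<^bsub>M\<^esub> (\<Delta> \<boxtimes>\<^bsub>M\<^esub> \<Delta>) \<and>
     \<Delta> \<cdot>\<^bsub>M\<^esub> u = (u \<boxtimes>\<^bsub>M\<^esub> u) \<cdot>\<^bsub>M\<^esub> Inv M (\<l>\<^bsub>M\<^esub> \<I>\<^bsub>M\<^esub>) \<and>
     \<epsilon> \<cdot>\<^bsub>M\<^esub> m = \<l>\<^bsub>M\<^esub> \<I>\<^bsub>M\<^esub> \<cdot>\<^bsub>M\<^esub> (\<epsilon> \<boxtimes>\<^bsub>M\<^esub> \<epsilon>) \<and>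
     \<epsilon> \<cdot>\<^bsub>M\<^esub> u = \<iota>\<^bsub>M\<^esub> \<I>\<^bsub>M\<^esub>"


section \<open>The categories of braided structures and their forgetful functors\<close>

text \<open>
  A morphism of structured objects carries its source and target, since the same
  arrow of the base category may be a morphism for several structures.
\<close>

datatype ('s, 'm) struct_arrow =
  SArr (sarr_dom: 's) (sarr: 'm) (sarr_cod: 's)

definition structured_category ::
    "('o, 'm, 'x) category_scheme \<Rightarrow> ('s \<Rightarrow> 'o) \<Rightarrow> 's set \<Rightarrow> ('s \<Rightarrow> 's \<Rightarrow> 'm \<Rightarrow> bool)
       \<Rightarrow> ('s, ('s, 'm) struct_arrow) category" where
  "structured_category C U S H =
     \<lparr>Obj = S,
      Arr = {f. sarr_dom f \<in> S \<and> sarr_cod f \<in> S \<and> H (sarr_dom f) (sarr_cod f) (sarr f)},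
      Dom = sarr_dom,
      Cod = sarr_cod,
      Ident = \<lambda>X. SArr X (\<iota>\<^bsub>C\<^esub> (U X)) X,
      Comp = \<lambda>g f. SArr (sarr_dom f) (sarr g \<cdot>\<^bsub>C\<^esub> sarr f) (sarr_cod g)\<rparr>"

record ('o, 'm) br_obj =
  base :: 'o
  braid :: 'm

record ('o, 'm) br_alg = "('o, 'm) br_obj" +
  mul :: 'm
  unt :: 'm

record ('o, 'm) br_bialg = "('o, 'm) br_alg" +
  comul :: 'm
  counit :: 'm

definition br_obj_mor ::
    "('o, 'm, 'x) monoidal_category_scheme
       \<Rightarrow> ('o, 'm, 'y) br_obj_scheme \<Rightarrow> ('o, 'm, 'z) br_obj_scheme \<Rightarrow> 'm \<Rightarrow> bool" where
  "br_obj_mor M V W f \<longleftrightarrow> braided_object_morphism M (base V) (braid V) (base W) (braid W) f"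

definition br_alg_mor ::
    "('o, 'm, 'x) monoidal_category_scheme
       \<Rightarrow> ('o, 'm, 'y) br_alg_scheme \<Rightarrow> ('o, 'm, 'z) br_alg_scheme \<Rightarrow> 'm \<Rightarrow> bool" where
  "br_alg_mor M A B f \<longleftrightarrow>
     br_obj_mor M A B f \<and>
     monoidal_algebra_morphism M (base A) (mul A) (unt A) (base B) (mul B) (unt B) f"

definition br_bialg_mor ::
    "('o, 'm, 'x) monoidal_category_scheme
       \<Rightarrow> ('o, 'm, 'y) br_bialg_scheme \<Rightarrow> ('o, 'm, 'z) br_bialg_scheme \<Rightarrow> 'm \<Rightarrow> bool" where
  "br_bialg_mor M A B f \<longleftrightarrow>
     br_alg_mor M A B f \<and>
     monoidal_coalgebra_morphism M (base A) (comul A) (counit A) (base B) (comul B) (counit B) f"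

definition Br ::
    "('o, 'm, 'x) monoidal_category_scheme
       \<Rightarrow> (('o, 'm) br_obj, (('o, 'm) br_obj, 'm) struct_arrow) category" where
  "Br M = structured_category M base {V. braided_object M (base V) (braid V)} (br_obj_mor M)"

definition BrAlg ::
    "('o, 'm, 'x) monoidal_category_scheme
       \<Rightarrow> (('o, 'm) br_alg, (('o, 'm) br_alg, 'm) struct_arrow) category" where
  "BrAlg M =
     structured_category M base {A. braided_algebra M (base A) (mul A) (unt A) (braid A)}
       (br_alg_mor M)"

definition BrBialg ::
    "('o, 'm, 'x) monoidal_category_scheme
       \<Rightarrow> (('o, 'm) br_bialg, (('o, 'm) br_bialg, 'm) struct_arrow) category" where
  "BrBialg M =
     structured_category M base
       {B. braided_bialgebra M (base B) (mul B) (unt B) (comul B) (counit B) (braid B)}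
       (br_bialg_mor M)"

definition forgetful_functor ::
    "('s \<Rightarrow> 't) \<Rightarrow> ('s, ('s, 'm) struct_arrow, 't, ('t, 'm) struct_arrow) functor_data" where
  "forgetful_functor t =
     \<lparr>on_obj = t, on_arr = \<lambda>f. SArr (t (sarr_dom f)) (sarr f) (t (sarr_cod f))\<rparr>"

text \<open>\<open>mho_Br\<close> forgets comultiplication and counit, \<open>Omega_Br\<close> forgets multiplication and unit.\<close>

definition mho_Br ::
    "(('o, 'm) br_bialg, (('o, 'm) br_bialg, 'm) struct_arrow,
      ('o, 'm) br_alg, (('o, 'm) br_alg, 'm) struct_arrow) functor_data" where
  "mho_Br = forgetful_functor br_alg.truncate"

definition Omega_Br ::
    "(('o, 'm) br_alg, (('o, 'm) br_alg, 'm) struct_arrow,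
      ('o, 'm) br_obj, (('o, 'm) br_obj, 'm) struct_arrow) functor_data" where
  "Omega_Br = forgetful_functor br_obj.truncate"

lemma category_structured_category:
  assumes C: "category C"
    and typed: "\<And>X Y f. \<lbrakk>X \<in> S; Y \<in> S; H X Y f\<rbrakk> \<Longrightarrow> f \<in> Hom C (U X) (U Y)"
    and ident_ok: "\<And>X. X \<in> S \<Longrightarrow> U X \<in> Obj C \<and> H X X (\<iota>\<^bsub>C\<^esub> (U X))"
    and comp_closed: "\<And>X Y Z f g. \<lbrakk>X \<in> S; Y \<in> S; Z \<in> S; H X Y f; H Y Z g\<rbrakk> \<Longrightarrow> H X Z (g \<cdot>\<^bsub>C\<^esub> f)"
  shows "category (structured_category C U S H)"
proof -
  interpret category C by (rule C)
  have Hom_iff: "f \<in> Hom (structured_category C U S H) X Y \<longleftrightarrow>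
      X \<in> S \<and> Y \<in> S \<and> (\<exists>h. f = SArr X h Y \<and> H X Y h)" for f X Y
    by (cases f) (auto simp: Hom_def structured_category_def)
  show ?thesis
  proof
    fix f g h W X Y Z
    let ?D = "structured_category C U S H"
    show "f \<in> Arr ?D \<Longrightarrow> Dom ?D f \<in> Obj ?D" "f \<in> Arr ?D \<Longrightarrow> Cod ?D f \<in> Obj ?D"
      by (auto simp: structured_category_def)
    show "X \<in> Obj ?D \<Longrightarrow> \<iota>\<^bsub>?D\<^esub> X \<in> Hom ?D X X"
      using ident_ok by (auto simp: Hom_iff) (auto simp: structured_category_def)
    show "\<lbrakk>f \<in> Hom ?D X Y; g \<in> Hom ?D Y Z\<rbrakk> \<Longrightarrow> g \<cdot>\<^bsub>?D\<^esub> f \<in> Hom ?D X Z"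
      using comp_closed by (auto simp: Hom_iff) (auto simp: structured_category_def)
    show "f \<in> Hom ?D X Y \<Longrightarrow> \<iota>\<^bsub>?D\<^esub> Y \<cdot>\<^bsub>?D\<^esub> f = f"
      using Comp_Ident_left[OF typed] by (auto simp: Hom_iff) (auto simp: structured_category_def)
    show "f \<in> Hom ?D X Y \<Longrightarrow> f \<cdot>\<^bsub>?D\<^esub> \<iota>\<^bsub>?D\<^esub> X = f"
      using Comp_Ident_right[OF typed] by (auto simp: Hom_iff) (auto simp: structured_category_def)
    show "\<lbrakk>f \<in> Hom ?D W X; g \<in> Hom ?D X Y; h \<in> Hom ?D Y Z\<rbrakk>
            \<Longrightarrow> (h \<cdot>\<^bsub>?D\<^esub> g) \<cdot>\<^bsub>?D\<^esub> f = h \<cdot>\<^bsub>?D\<^esub> g \<cdot>\<^bsub>?D\<^esub> f"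
      using Comp_assoc[OF typed typed typed] by (auto simp: Hom_iff) (auto simp: structured_category_def)
  qed
qed

context monoidal_category
begin

lemma square_Ident:
  assumes "X \<in> Obj M" "k \<in> Hom M (X \<boxdot> X) (X \<boxdot> X)"
  shows "k \<cdot> (\<iota> X \<boxtimes> \<iota> X) = k" "(\<iota> X \<boxtimes> \<iota> X) \<cdot> k = k"
  using assms by (auto simp: Ten_Ident Comp_Ident_left Comp_Ident_right)

lemma braided_object_morphism_Ident:
  "braided_object M V c \<Longrightarrow> braided_object_morphism M V c V c (\<iota> V)"
  by (auto simp: braided_object_def braided_object_morphism_def Ident_in_Hom square_Ident)

lemma braided_object_morphism_Comp:
  assumes c: "c \<in> Hom M (V \<boxdot> V) (V \<boxdot> V)" "c' \<in> Hom M (V' \<boxdot> V') (V' \<boxdot> V')"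
    "c'' \<in> Hom M (V'' \<boxdot> V'') (V'' \<boxdot> V'')"
    and "braided_object_morphism M V c V' c' f" "braided_object_morphism M V' c' V'' c'' g"
  shows "braided_object_morphism M V c V'' c'' (g \<cdot> f)"
proof -
  have f: "f \<in> Hom M V V'" and g: "g \<in> Hom M V' V''"
    and cf: "c' \<cdot> (f \<boxtimes> f) = (f \<boxtimes> f) \<cdot> c" and cg: "c'' \<cdot> (g \<boxtimes> g) = (g \<boxtimes> g) \<cdot> c'"
    using assms(4,5) by (auto simp: braided_object_morphism_def)
  note ff = Ten_in_Hom[OF f f] and gg = Ten_in_Hom[OF g g]
  have "c'' \<cdot> ((g \<cdot> f) \<boxtimes> (g \<cdot> f)) = (c'' \<cdot> (g \<boxtimes> g)) \<cdot> (f \<boxtimes> f)"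
    using Ten_Comp[OF f g f g] Comp_assoc[OF ff gg c(3)] by simp
  also have "\<dots> = (g \<boxtimes> g) \<cdot> (f \<boxtimes> f) \<cdot> c"
    using Comp_assoc[OF ff c(2) gg] by (simp add: cf cg)
  also have "\<dots> = ((g \<cdot> f) \<boxtimes> (g \<cdot> f)) \<cdot> c"
    using Ten_Comp[OF f g f g] Comp_assoc[OF c(1) ff gg] by simp
  finally show ?thesis
    using Comp_in_Hom[OF f g] by (simp add: braided_object_morphism_def)
qed

lemma monoidal_algebra_morphism_Ident:
  "monoidal_algebra M A m u \<Longrightarrow> monoidal_algebra_morphism M A m u A m u (\<iota> A)"
  by (auto simp: monoidal_algebra_def monoidal_algebra_morphism_def Ident_in_Hom
      Ten_Ident Comp_Ident_left Comp_Ident_right)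

lemma monoidal_algebra_morphism_Comp:
  assumes "monoidal_algebra M A m u" "monoidal_algebra M A' m' u'" "monoidal_algebra M A'' m'' u''"
    and "monoidal_algebra_morphism M A m u A' m' u' f"
    and "monoidal_algebra_morphism M A' m' u' A'' m'' u'' g"
  shows "monoidal_algebra_morphism M A m u A'' m'' u'' (g \<cdot> f)"
proof -
  have f: "f \<in> Hom M A A'" and g: "g \<in> Hom M A' A''"
    and mf: "f \<cdot> m = m' \<cdot> (f \<boxtimes> f)" and mg: "g \<cdot> m' = m'' \<cdot> (g \<boxtimes> g)"
    and uf: "f \<cdot> u = u'" and ug: "g \<cdot> u' = u''"
    using assms(4,5) by (auto simp: monoidal_algebra_morphism_def)
  have m: "m \<in> Hom M (A \<boxdot> A) A" "m' \<in> Hom M (A' \<boxdot> A') A'" "m'' \<in> Hom M (A'' \<boxdot> A'') A''"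
    and u: "u \<in> Hom M \<I> A"
    using assms(1-3) by (auto simp: monoidal_algebra_def)
  note ff = Ten_in_Hom[OF f f] and gg = Ten_in_Hom[OF g g]
  have "(g \<cdot> f) \<cdot> m = (g \<cdot> m') \<cdot> (f \<boxtimes> f)"
    using Comp_assoc[OF m(1) f g] Comp_assoc[OF ff m(2) g] by (simp add: mf)
  also have "\<dots> = m'' \<cdot> ((g \<cdot> f) \<boxtimes> (g \<cdot> f))"
    using Comp_assoc[OF ff gg m(3)] Ten_Comp[OF f g f g] by (simp add: mg)
  finally show ?thesis
    using Comp_in_Hom[OF f g] Comp_assoc[OF u f g]
    by (simp add: monoidal_algebra_morphism_def uf ug)
qed

lemma monoidal_coalgebra_morphism_Ident:
  "monoidal_coalgebra M C \<Delta> \<epsilon> \<Longrightarrow> monoidal_coalgebra_morphism M C \<Delta> \<epsilon> C \<Delta> \<epsilon> (\<iota> C)"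
  by (auto simp: monoidal_coalgebra_def monoidal_coalgebra_morphism_def Ident_in_Hom
      Ten_Ident Comp_Ident_left Comp_Ident_right)

lemma monoidal_coalgebra_morphism_Comp:
  assumes "monoidal_coalgebra M C \<Delta> \<epsilon>" "monoidal_coalgebra M C' \<Delta>' \<epsilon>'"
    "monoidal_coalgebra M C'' \<Delta>'' \<epsilon>''"
    and "monoidal_coalgebra_morphism M C \<Delta> \<epsilon> C' \<Delta>' \<epsilon>' f"
    and "monoidal_coalgebra_morphism M C' \<Delta>' \<epsilon>' C'' \<Delta>'' \<epsilon>'' g"
  shows "monoidal_coalgebra_morphism M C \<Delta> \<epsilon> C'' \<Delta>'' \<epsilon>'' (g \<cdot> f)"
proof -
  have f: "f \<in> Hom M C C'" and g: "g \<in> Hom M C' C''"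
    and df: "\<Delta>' \<cdot> f = (f \<boxtimes> f) \<cdot> \<Delta>" and dg: "\<Delta>'' \<cdot> g = (g \<boxtimes> g) \<cdot> \<Delta>'"
    and ef: "\<epsilon>' \<cdot> f = \<epsilon>" and eg: "\<epsilon>'' \<cdot> g = \<epsilon>'"
    using assms(4,5) by (auto simp: monoidal_coalgebra_morphism_def)
  have d: "\<Delta> \<in> Hom M C (C \<boxdot> C)" "\<Delta>' \<in> Hom M C' (C' \<boxdot> C')" "\<Delta>'' \<in> Hom M C'' (C'' \<boxdot> C'')"
    and e: "\<epsilon>'' \<in> Hom M C'' \<I>"
    using assms(1-3) by (auto simp: monoidal_coalgebra_def)
  note ff = Ten_in_Hom[OF f f] and gg = Ten_in_Hom[OF g g]
  have "\<Delta>'' \<cdot> g \<cdot> f = (g \<boxtimes> g) \<cdot> \<Delta>' \<cdot> f"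
    using Comp_assoc[OF f g d(3)] Comp_assoc[OF f d(2) gg] by (simp add: dg)
  also have "\<dots> = ((g \<cdot> f) \<boxtimes> (g \<cdot> f)) \<cdot> \<Delta>"
    using Comp_assoc[OF d(1) ff gg] Ten_Comp[OF f g f g] by (simp add: df)
  finally show ?thesis
    using Comp_in_Hom[OF f g] Comp_assoc[OF f g e]
    by (simp add: monoidal_coalgebra_morphism_def ef eg)
qed

lemma category_Br: "category (Br M)"
  unfolding Br_def
proof (rule category_structured_category)
  show "category M" by unfold_locales
next
  fix X Y Z :: "('o, 'm) br_obj" and f g
  assume "X \<in> {V. braided_object M (base V) (braid V)}" "Y \<in> {V. braided_object M (base V) (braid V)}"
    "Z \<in> {V. braided_object M (base V) (braid V)}" "br_obj_mor M X Y f" "br_obj_mor M Y Z g"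
  then show "br_obj_mor M X Z (g \<cdot> f)"
    unfolding br_obj_mor_def braided_object_def by (blast intro: braided_object_morphism_Comp)
qed (auto simp: br_obj_mor_def braided_object_morphism_Ident,
     auto simp: braided_object_morphism_def braided_object_def)

lemma category_BrAlg: "category (BrAlg M)"
  unfolding BrAlg_def
proof (rule category_structured_category)
  show "category M" by unfold_locales
next
  fix X Y Z :: "('o, 'm) br_alg" and f g
  let ?S = "{A. braided_algebra M (base A) (mul A) (unt A) (braid A)}"
  assume "X \<in> ?S" "Y \<in> ?S" "Z \<in> ?S" "br_alg_mor M X Y f" "br_alg_mor M Y Z g"
  then show "br_alg_mor M X Z (g \<cdot> f)"
    unfolding br_alg_mor_def br_obj_mor_def braided_algebra_def braided_object_def mem_Collect_eq
    by (blast intro: braided_object_morphism_Comp monoidal_algebra_morphism_Comp)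
qed (auto simp: br_alg_mor_def br_obj_mor_def braided_algebra_def braided_object_morphism_Ident
       monoidal_algebra_morphism_Ident,
     auto simp: braided_object_morphism_def braided_object_def)

lemma category_BrBialg: "category (BrBialg M)"
  unfolding BrBialg_def
proof (rule category_structured_category)
  show "category M" by unfold_locales
next
  fix X Y Z :: "('o, 'm) br_bialg" and f g
  let ?S = "{B. braided_bialgebra M (base B) (mul B) (unt B) (comul B) (counit B) (braid B)}"
  assume "X \<in> ?S" "Y \<in> ?S" "Z \<in> ?S" "br_bialg_mor M X Y f" "br_bialg_mor M Y Z g"
  then show "br_bialg_mor M X Z (g \<cdot> f)"
    unfolding br_bialg_mor_def br_alg_mor_def br_obj_mor_def braided_bialgebra_def
      braided_coalgebra_def braided_algebra_def braided_object_def mem_Collect_eq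
    by (blast intro: braided_object_morphism_Comp monoidal_algebra_morphism_Comp
        monoidal_coalgebra_morphism_Comp)
qed (auto simp: br_bialg_mor_def br_alg_mor_def br_obj_mor_def braided_bialgebra_def
       braided_coalgebra_def braided_algebra_def braided_object_morphism_Ident
       monoidal_algebra_morphism_Ident monoidal_coalgebra_morphism_Ident,
     auto simp: braided_object_morphism_def braided_object_def)

lemma mho_Br_functor: "cat_functor (BrBialg M) (BrAlg M) mho_Br"
proof (intro cat_functor.intro category_BrBialg category_BrAlg cat_functor_axioms.intro)
qed (auto simp: mho_Br_def forgetful_functor_def BrBialg_def BrAlg_def structured_category_def
      Hom_def br_alg.truncate_def braided_bialgebra_def br_bialg_mor_def br_alg_mor_def br_obj_mor_def)

lemma Omega_Br_functor: "cat_functor (BrAlg M) (Br M) Omega_Br"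
proof (intro cat_functor.intro category_BrAlg category_Br cat_functor_axioms.intro)
qed (auto simp: Omega_Br_def forgetful_functor_def BrAlg_def Br_def structured_category_def
      Hom_def br_obj.truncate_def braided_algebra_def br_alg_mor_def br_obj_mor_def)

end


section \<open>The primitive part of a braided bialgebra\<close>

definition primitive_target ::
    "('o, 'm, 'x) preadditive_monoidal_category_scheme \<Rightarrow> ('o, 'm) br_bialg \<Rightarrow> 'm" where
  "primitive_target M A =
     ((\<iota>\<^bsub>M\<^esub> (base A) \<boxtimes>\<^bsub>M\<^esub> unt A) \<cdot>\<^bsub>M\<^esub> Inv M (\<r>\<^bsub>M\<^esub> (base A)))
     \<boxplus>\<^bsub>M\<^esub> ((unt A \<boxtimes>\<^bsub>M\<^esub> \<iota>\<^bsub>M\<^esub> (base A)) \<cdot>\<^bsub>M\<^esub> Inv M (\<l>\<^bsub>M\<^esub> (base A)))"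

definition primitive_choice ::
    "('o, 'm, 'x) preadditive_monoidal_category_scheme
       \<Rightarrow> (('o, 'm) br_bialg \<Rightarrow> 'o) \<Rightarrow> (('o, 'm) br_bialg \<Rightarrow> 'm) \<Rightarrow> bool" where
  "primitive_choice M P \<xi> \<longleftrightarrow>
     (\<forall>A\<in>Obj (BrBialg M). is_equalizer M (comul A) (primitive_target M A) (P A) (\<xi> A))"

text \<open>The definite descriptions below denote the morphisms singled out by the
  displayed equations as soon as these exist uniquely.\<close>

definition primitive_braiding ::
    "('o, 'm, 'x) monoidal_category_scheme
       \<Rightarrow> (('o, 'm) br_bialg \<Rightarrow> 'o) \<Rightarrow> (('o, 'm) br_bialg \<Rightarrow> 'm) \<Rightarrow> ('o, 'm) br_bialg \<Rightarrow> 'm" where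
  "primitive_braiding M P \<xi> A =
     (THE c. c \<in> Hom M (P A \<boxdot>\<^bsub>M\<^esub> P A) (P A \<boxdot>\<^bsub>M\<^esub> P A) \<and>
        (\<xi> A \<boxtimes>\<^bsub>M\<^esub> \<xi> A) \<cdot>\<^bsub>M\<^esub> c = braid A \<cdot>\<^bsub>M\<^esub> (\<xi> A \<boxtimes>\<^bsub>M\<^esub> \<xi> A))"

definition primitive_map ::
    "('o, 'm, 'x) monoidal_category_scheme
       \<Rightarrow> (('o, 'm) br_bialg \<Rightarrow> 'o) \<Rightarrow> (('o, 'm) br_bialg \<Rightarrow> 'm)
       \<Rightarrow> (('o, 'm) br_bialg, 'm) struct_arrow \<Rightarrow> 'm" where
  "primitive_map M P \<xi> f =
     (THE h. h \<in> Hom M (P (sarr_dom f)) (P (sarr_cod f)) \<and>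
        \<xi> (sarr_cod f) \<cdot>\<^bsub>M\<^esub> h = sarr f \<cdot>\<^bsub>M\<^esub> \<xi> (sarr_dom f))"

definition P_Br_obj ::
    "('o, 'm, 'x) monoidal_category_scheme
       \<Rightarrow> (('o, 'm) br_bialg \<Rightarrow> 'o) \<Rightarrow> (('o, 'm) br_bialg \<Rightarrow> 'm)
       \<Rightarrow> ('o, 'm) br_bialg \<Rightarrow> ('o, 'm) br_obj" where
  "P_Br_obj M P \<xi> A = \<lparr>base = P A, braid = primitive_braiding M P \<xi> A\<rparr>"

definition P_Br ::
    "('o, 'm, 'x) monoidal_category_scheme
       \<Rightarrow> (('o, 'm) br_bialg \<Rightarrow> 'o) \<Rightarrow> (('o, 'm) br_bialg \<Rightarrow> 'm)
       \<Rightarrow> (('o, 'm) br_bialg, (('o, 'm) br_bialg, 'm) struct_arrow,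
           ('o, 'm) br_obj, (('o, 'm) br_obj, 'm) struct_arrow) functor_data" where
  "P_Br M P \<xi> =
     \<lparr>on_obj = P_Br_obj M P \<xi>,
      on_arr = \<lambda>f. SArr (P_Br_obj M P \<xi> (sarr_dom f)) (primitive_map M P \<xi> f)
                        (P_Br_obj M P \<xi> (sarr_cod f))\<rparr>"

end

theory Submission
  imports Defs
begin

text \<open>
  Write \<open>q = (A \<otimes> u) r\<inverse> + (u \<otimes> A) l\<inverse>\<close>. Naturality of the constraints and the unit axioms of a
  braided algebra show that \<open>c\<close> commutes with \<open>q\<close> in the same way as it does with \<open>\<Delta>\<close>:
  \<open>(A \<otimes> q) c = (c \<otimes> A)(A \<otimes> c)(q \<otimes> A)\<close>, and the mirror identity. As \<open>\<Delta> \<xi> = q \<xi>\<close>, the arrow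
  \<open>c (\<xi> \<otimes> A)\<close> equalizes \<open>A \<otimes> \<Delta>\<close> and \<open>A \<otimes> q\<close>, so it factors through \<open>A \<otimes> \<xi>\<close>; likewise
  \<open>c (A \<otimes> \<xi>)\<close> factors through \<open>\<xi> \<otimes> A\<close>. Hence \<open>c (\<xi> \<otimes> \<xi>)\<close> factors through both \<open>A \<otimes> P\<close> and
  \<open>P \<otimes> A\<close>, whose intersection is \<open>P \<otimes> P\<close>. The two identities pass to \<open>c\<inverse>\<close>, which makes the
  restriction invertible; everything else follows since the tensor powers of \<open>\<xi>\<close> are monic.
\<close>

section \<open>Arrows in a category\<close>

context category
begin

section \<open>Typing and normal forms of composites\<close>

lemma HomI: "\<lbrakk>f \<in> Arr C; Dom C f = X; Cod C f = Y\<rbrakk> \<Longrightarrow> f \<in> Hom C X Y"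
  by (simp add: Hom_def)

lemma HomD:
  assumes "f \<in> Hom C X Y"
  shows "f \<in> Arr C" "Dom C f = X" "Cod C f = Y" "X \<in> Obj C" "Y \<in> Obj C"
  using assms Dom_in_Obj Cod_in_Obj by (auto simp: Hom_def)

lemma Ident_simps [simp]:
  assumes "X \<in> Obj C"
  shows "\<iota> X \<in> Arr C" "Dom C (\<iota> X) = X" "Cod C (\<iota> X) = X"
  using HomD[OF Ident_in_Hom[OF assms]] by auto

text \<open>Hom-set membership is split into three conditions on \<open>Arr\<close>,
  \<open>Dom\<close> and \<open>Cod\<close>, so that simplification can compute the type of a
  composite without guessing the intermediate object.\<close>

lemma Comp_simps [simp]:
  assumes "f \<in> Arr C" "g \<in> Arr C" "Dom C g = Cod C f"
  shows "g \<cdot> f \<in> Arr C" "Dom C (g \<cdot> f) = Dom C f" "Cod C (g \<cdot> f) = Cod C g"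
  using HomD[OF Comp_in_Hom[of f "Dom C f" "Cod C f" g "Cod C g"]] assms by (auto simp: Hom_def)

lemma Comp_assoc_simp [simp]:
  assumes "f \<in> Arr C" "g \<in> Arr C" "h \<in> Arr C" "Dom C g = Cod C f" "Dom C h = Cod C g"
  shows "(h \<cdot> g) \<cdot> f = h \<cdot> g \<cdot> f"
  using assms by (intro Comp_assoc) (auto simp: Hom_def)

lemma Comp_Ident_simps [simp]:
  assumes "f \<in> Arr C"
  shows "Cod C f = Y \<Longrightarrow> \<iota> Y \<cdot> f = f" "Dom C f = X \<Longrightarrow> f \<cdot> \<iota> X = f"
  using assms Comp_Ident_left Comp_Ident_right by (auto simp: Hom_def)

text \<open>Composites are normalized to bracket to the right, so \<open>g \<cdot> f\<close> need
  not be a subterm when another arrow follows. This turns an equation for it into one that applies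
  inside a longer composite.\<close>

lemma Comp_reduce:
  assumes "g \<cdot> f = h" "f \<in> Arr C" "g \<in> Arr C" "k \<in> Arr C" "Dom C g = Cod C f" "Cod C k = Dom C f"
  shows "g \<cdot> f \<cdot> k = h \<cdot> k"
  using assms(2-) by (simp flip: assms(1))

section \<open>Inverses and cancellation of isomorphisms\<close>

lemma inverse_arrows_unique:
  assumes "inverse_arrows C f g" "inverse_arrows C f h"
  shows "g = h"
proof -
  have [simp]: "f \<in> Arr C" "g \<in> Arr C" "h \<in> Arr C" "Dom C g = Cod C f" "Cod C g = Dom C f"
    "Dom C h = Cod C f" "Cod C h = Dom C f"
    and gf: "g \<cdot> f = \<iota> (Dom C f)" and fh: "f \<cdot> h = \<iota> (Cod C f)"
    using assms by (auto simp: inverse_arrows_def Hom_def)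
  show ?thesis
    using Comp_reduce[OF gf, of h] by (simp add: fh)
qed

lemma inverse_arrows_Inv:
  assumes "is_iso C f"
  shows "inverse_arrows C f (Inv C f)"
proof -
  obtain g where "inverse_arrows C f g"
    using assms by (auto simp: is_iso_def)
  then show ?thesis
    unfolding Inv_def by (rule theI) (use \<open>inverse_arrows C f g\<close> inverse_arrows_unique in blast)
qed

lemma Inv_simps:
  assumes "is_iso C f"
  shows "f \<in> Arr C" "Inv C f \<in> Arr C" "Dom C (Inv C f) = Cod C f" "Cod C (Inv C f) = Dom C f"
    "Inv C f \<cdot> f = \<iota> (Dom C f)" "f \<cdot> Inv C f = \<iota> (Cod C f)"
    "\<lbrakk>k \<in> Arr C; Cod C k = Dom C f\<rbrakk> \<Longrightarrow> Inv C f \<cdot> f \<cdot> k = k"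
    "\<lbrakk>k \<in> Arr C; Cod C k = Cod C f\<rbrakk> \<Longrightarrow> f \<cdot> Inv C f \<cdot> k = k"
proof -
  show *: "f \<in> Arr C" "Inv C f \<in> Arr C" "Dom C (Inv C f) = Cod C f" "Cod C (Inv C f) = Dom C f"
    and "Inv C f \<cdot> f = \<iota> (Dom C f)" "f \<cdot> Inv C f = \<iota> (Cod C f)"
    using inverse_arrows_Inv[OF assms] by (auto simp: inverse_arrows_def Hom_def)
  then show "\<lbrakk>k \<in> Arr C; Cod C k = Dom C f\<rbrakk> \<Longrightarrow> Inv C f \<cdot> f \<cdot> k = k"
    "\<lbrakk>k \<in> Arr C; Cod C k = Cod C f\<rbrakk> \<Longrightarrow> f \<cdot> Inv C f \<cdot> k = k"
    using Comp_reduce[of "Inv C f" f _ k] Comp_reduce[of f "Inv C f" _ k] by auto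
qed

lemma Comp_iso_cancel:
  assumes eq: "g \<cdot> f = h \<cdot> f"
    and f: "is_iso C f" "g \<in> Arr C" "h \<in> Arr C" "Dom C g = Cod C f" "Dom C h = Cod C f"
  shows "g = h"
proof -
  have "(g \<cdot> f) \<cdot> Inv C f = (h \<cdot> f) \<cdot> Inv C f"
    using eq by simp
  then show ?thesis
    using f(2-) by (simp add: Inv_simps[OF f(1)])
qed

lemma iso_Comp_cancel:
  assumes eq: "f \<cdot> g = f \<cdot> h"
    and f: "is_iso C f" "g \<in> Arr C" "h \<in> Arr C" "Cod C g = Dom C f" "Cod C h = Dom C f"
  shows "g = h"
proof -
  have "Inv C f \<cdot> f \<cdot> g = Inv C f \<cdot> f \<cdot> h"
    using eq by simp
  then show ?thesis
    using f(2-) by (simp add: Inv_simps[OF f(1)])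
qed

section \<open>Monomorphisms and equalizers\<close>

definition mono_arr :: "'m \<Rightarrow> bool" where
  "mono_arr f \<longleftrightarrow> f \<in> Arr C \<and>
     (\<forall>Z g h. g \<in> Hom C Z (Dom C f) \<longrightarrow> h \<in> Hom C Z (Dom C f) \<longrightarrow> f \<cdot> g = f \<cdot> h \<longrightarrow> g = h)"

lemma mono_arrD:
  "\<lbrakk>mono_arr f; f \<cdot> g = f \<cdot> h; g \<in> Hom C Z (Dom C f); h \<in> Hom C Z (Dom C f)\<rbrakk> \<Longrightarrow> g = h"
  by (auto simp: mono_arr_def)

lemma mono_arr_Comp:
  assumes "mono_arr f" "mono_arr g" "Dom C g = Cod C f"
  shows "mono_arr (g \<cdot> f)"
  unfolding mono_arr_def
proof (intro conjI allI impI)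
  have [simp]: "f \<in> Arr C" "g \<in> Arr C"
    using assms by (auto simp: mono_arr_def)
  show "g \<cdot> f \<in> Arr C"
    using assms(3) by simp
  fix Z h k
  assume "h \<in> Hom C Z (Dom C (g \<cdot> f))" "k \<in> Hom C Z (Dom C (g \<cdot> f))"
    and eq: "(g \<cdot> f) \<cdot> h = (g \<cdot> f) \<cdot> k"
  then have hk: "h \<in> Hom C Z (Dom C f)" "k \<in> Hom C Z (Dom C f)"
    using assms(3) by auto
  note [simp] = HomD(1-3)[OF hk(1)] HomD(1-3)[OF hk(2)] assms(3)
  have "f \<cdot> h = f \<cdot> k"
    by (rule mono_arrD[OF assms(2)]) (use eq in \<open>auto intro!: HomI\<close>)
  then show "h = k"
    by (rule mono_arrD[OF assms(1)]) (use hk in auto)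
qed

lemma equalizer_Hom:
  assumes "is_equalizer C f g E e" "f \<in> Hom C X Y"
  shows "e \<in> Hom C E X" "f \<cdot> e = g \<cdot> e" "g \<in> Hom C X Y"
  using assms by (auto simp: is_equalizer_def Hom_def)

text \<open>Two arrows with the same composite with \<open>e\<close> are both factorizations of that
  composite, which itself equalizes the pair; the uniqueness half of the universal property
  identifies them.\<close>

lemma equalizer_mono:
  assumes "is_equalizer C f g E e"
  shows "mono_arr e"
  unfolding mono_arr_def
proof (intro conjI allI impI)
  obtain X Y where f: "f \<in> Hom C X Y" and g: "g \<in> Hom C X Y"
    and e: "e \<in> Hom C E X" and eq: "f \<cdot> e = g \<cdot> e"
    and univ: "\<And>Z h. h \<in> Hom C Z X \<Longrightarrow> f \<cdot> h = g \<cdot> h \<Longrightarrow> \<exists>!k. k \<in> Hom C Z E \<and> e \<cdot> k = h"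
    using assms by (auto simp: is_equalizer_def)
  note [simp] = HomD[OF f] HomD[OF g] HomD[OF e]
  show "e \<in> Arr C"
    by simp
  fix Z h k
  assume "h \<in> Hom C Z (Dom C e)" "k \<in> Hom C Z (Dom C e)" and ehk: "e \<cdot> h = e \<cdot> k"
  then have hk: "h \<in> Hom C Z E" "k \<in> Hom C Z E"
    by auto
  note [simp] = HomD(1-3)[OF hk(1)] HomD(1-3)[OF hk(2)]
  have "f \<cdot> e \<cdot> h = g \<cdot> e \<cdot> h"
    using Comp_reduce[OF eq, of h] by simp
  then show "h = k"
    using univ[of "e \<cdot> h" Z] hk ehk by (metis Comp_in_Hom e)
qed

text \<open>The predicate \<open>is_equalizer\<close> hides the common source and target of the pair
  behind an existential quantifier. An arrow has only one source, so the hidden one must be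
  \<open>X\<close>.\<close>

lemma equalizer_factor:
  assumes "is_equalizer C f g E e" "f \<in> Hom C X Y" "h \<in> Hom C Z X" "f \<cdot> h = g \<cdot> h"
  obtains k where "k \<in> Hom C Z E" "e \<cdot> k = h"
proof -
  obtain X' Y' where f: "f \<in> Hom C X' Y'"
    and univ: "\<And>Z h. h \<in> Hom C Z X' \<Longrightarrow> f \<cdot> h = g \<cdot> h \<Longrightarrow> \<exists>!k. k \<in> Hom C Z E \<and> e \<cdot> k = h"
    using assms(1) by (auto simp: is_equalizer_def)
  have "X' = X"
    using HomD(2)[OF f] HomD(2)[OF assms(2)] by simp
  then show thesis
    using univ[of h Z] assms(3,4) that by blast
qed

end

section \<open>Monoidal categories\<close>

context monoidal_category
begin

lemmas [simp] = Ten_in_Obj Unit_in_Obj Ten_Ident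

section \<open>Tensor products of arrows and typing of the constraints\<close>

lemma Ten_simps [simp]:
  assumes "f \<in> Arr M" "g \<in> Arr M"
  shows "f \<boxtimes> g \<in> Arr M" "Dom M (f \<boxtimes> g) = Dom M f \<boxdot> Dom M g"
    "Cod M (f \<boxtimes> g) = Cod M f \<boxdot> Cod M g"
  using HomD[OF Ten_in_Hom[of f "Dom M f" "Cod M f" g "Dom M g" "Cod M g"]] assms
  by (auto simp: Hom_def)

text \<open>The interchange law is oriented so as to collect factors:
  \<open>(f \<boxtimes> \<iota> Y') \<cdot> (\<iota> X \<boxtimes> g)\<close> and the composite in
  the other order both become \<open>f \<boxtimes> g\<close> once identities are removed.\<close>

lemma Ten_Comp_merge:
  assumes "f \<in> Arr M" "f' \<in> Arr M" "g \<in> Arr M" "g' \<in> Arr M"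
    and "Dom M f' = Cod M f" "Dom M g' = Cod M g"
  shows "(f' \<boxtimes> g') \<cdot> (f \<boxtimes> g) = (f' \<cdot> f) \<boxtimes> (g' \<cdot> g)"
  using Ten_Comp[of f "Dom M f" "Cod M f" f' "Cod M f'" g "Dom M g" "Cod M g" g' "Cod M g'"] assms
  by (simp add: Hom_def)

lemma Ten_Comp_merge_reduce:
  assumes "f \<in> Arr M" "f' \<in> Arr M" "g \<in> Arr M" "g' \<in> Arr M" "k \<in> Arr M"
    and "Dom M f' = Cod M f" "Dom M g' = Cod M g" "Cod M k = Dom M f \<boxdot> Dom M g"
  shows "(f' \<boxtimes> g') \<cdot> (f \<boxtimes> g) \<cdot> k = ((f' \<cdot> f) \<boxtimes> (g' \<cdot> g)) \<cdot> k"
  using assms by (simp flip: Ten_Comp_merge)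

lemmas Ten_merge = Ten_Comp_merge Ten_Comp_merge_reduce

lemma Assoc_simps [simp]:
  assumes "X \<in> Obj M" "Y \<in> Obj M" "Z \<in> Obj M"
  shows "\<a> X Y Z \<in> Arr M" "Dom M (\<a> X Y Z) = (X \<boxdot> Y) \<boxdot> Z" "Cod M (\<a> X Y Z) = X \<boxdot> (Y \<boxdot> Z)"
  using HomD[OF Assoc_in_Hom[OF assms]] by auto

lemma Unit_simps [simp]:
  assumes "X \<in> Obj M"
  shows "\<l> X \<in> Arr M" "Dom M (\<l> X) = \<I> \<boxdot> X" "Cod M (\<l> X) = X"
    "\<r> X \<in> Arr M" "Dom M (\<r> X) = X \<boxdot> \<I>" "Cod M (\<r> X) = X"
  using HomD[OF Lunit_in_Hom[OF assms]] HomD[OF Runit_in_Hom[OF assms]] by auto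

lemma Inv_Assoc_simps [simp]:
  assumes [simp]: "X \<in> Obj M" "Y \<in> Obj M" "Z \<in> Obj M"
  shows "Inv M (\<a> X Y Z) \<in> Arr M" "Dom M (Inv M (\<a> X Y Z)) = X \<boxdot> (Y \<boxdot> Z)"
    "Cod M (Inv M (\<a> X Y Z)) = (X \<boxdot> Y) \<boxdot> Z"
    "Inv M (\<a> X Y Z) \<cdot> \<a> X Y Z = \<iota> (X \<boxdot> Y \<boxdot> Z)"
    "\<a> X Y Z \<cdot> Inv M (\<a> X Y Z) = \<iota> (X \<boxdot> (Y \<boxdot> Z))"
    "\<lbrakk>k \<in> Arr M; Cod M k = X \<boxdot> Y \<boxdot> Z\<rbrakk> \<Longrightarrow> Inv M (\<a> X Y Z) \<cdot> \<a> X Y Z \<cdot> k = k"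
    "\<lbrakk>k \<in> Arr M; Cod M k = X \<boxdot> (Y \<boxdot> Z)\<rbrakk> \<Longrightarrow> \<a> X Y Z \<cdot> Inv M (\<a> X Y Z) \<cdot> k = k"
  using Inv_simps[OF Assoc_iso[OF assms]] by auto

lemma Inv_unit_simps [simp]:
  assumes [simp]: "X \<in> Obj M"
  shows "Inv M (\<l> X) \<in> Arr M" "Dom M (Inv M (\<l> X)) = X" "Cod M (Inv M (\<l> X)) = \<I> \<boxdot> X"
    "Inv M (\<r> X) \<in> Arr M" "Dom M (Inv M (\<r> X)) = X" "Cod M (Inv M (\<r> X)) = X \<boxdot> \<I>"
    "Inv M (\<l> X) \<cdot> \<l> X = \<iota> (\<I> \<boxdot> X)" "\<l> X \<cdot> Inv M (\<l> X) = \<iota> X"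
    "Inv M (\<r> X) \<cdot> \<r> X = \<iota> (X \<boxdot> \<I>)" "\<r> X \<cdot> Inv M (\<r> X) = \<iota> X"
    "\<lbrakk>k \<in> Arr M; Cod M k = X\<rbrakk> \<Longrightarrow> \<l> X \<cdot> Inv M (\<l> X) \<cdot> k = k"
    "\<lbrakk>k \<in> Arr M; Cod M k = X\<rbrakk> \<Longrightarrow> \<r> X \<cdot> Inv M (\<r> X) \<cdot> k = k"
  using Inv_simps[OF Lunit_iso[of X]] Inv_simps[OF Runit_iso[of X]] by auto

section \<open>Naturality of the constraints and of their inverses\<close>

lemma Assoc_nat:
  assumes "f \<in> Arr M" "g \<in> Arr M" "h \<in> Arr M"
  shows "\<a> (Cod M f) (Cod M g) (Cod M h) \<cdot> ((f \<boxtimes> g) \<boxtimes> h)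
    = (f \<boxtimes> (g \<boxtimes> h)) \<cdot> \<a> (Dom M f) (Dom M g) (Dom M h)"
  using assms by (intro Assoc_natural) (auto simp: Hom_def)

text \<open>Naturality of \<open>\<a>\<close> is composed with the inverse constraint at the
  sources, and \<open>\<a>\<close> at the targets is then cancelled on the left. The two inverse
  unit constraints are treated in the same way.\<close>

lemma Inv_Assoc_nat:
  assumes [simp]: "f \<in> Arr M" "g \<in> Arr M" "h \<in> Arr M"
  shows "Inv M (\<a> (Cod M f) (Cod M g) (Cod M h)) \<cdot> (f \<boxtimes> (g \<boxtimes> h))
    = ((f \<boxtimes> g) \<boxtimes> h) \<cdot> Inv M (\<a> (Dom M f) (Dom M g) (Dom M h))"
proof -
  note [simp] = Dom_in_Obj Cod_in_Obj
  show ?thesis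
    using Comp_reduce[OF Assoc_nat[of f g h], of "Inv M (\<a> (Dom M f) (Dom M g) (Dom M h))"]
    by - (rule iso_Comp_cancel[OF _ Assoc_iso[of "Cod M f" "Cod M g" "Cod M h"]], simp_all)
qed

lemma Lunit_nat: "f \<in> Arr M \<Longrightarrow> \<l> (Cod M f) \<cdot> (\<iota> \<I> \<boxtimes> f) = f \<cdot> \<l> (Dom M f)"
  by (intro Lunit_natural) (simp add: Hom_def)

lemma Runit_nat: "f \<in> Arr M \<Longrightarrow> \<r> (Cod M f) \<cdot> (f \<boxtimes> \<iota> \<I>) = f \<cdot> \<r> (Dom M f)"
  by (intro Runit_natural) (simp add: Hom_def)

lemma Inv_Lunit_nat:
  assumes [simp]: "f \<in> Arr M" "Dom M f = X" "Cod M f = Y"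
  shows "Inv M (\<l> Y) \<cdot> f = (\<iota> \<I> \<boxtimes> f) \<cdot> Inv M (\<l> X)"
proof -
  have [simp]: "X \<in> Obj M" "Y \<in> Obj M"
    using Dom_in_Obj[of f] Cod_in_Obj[of f] by simp_all
  show ?thesis
    using Comp_reduce[OF Lunit_nat[of f], of "Inv M (\<l> X)"]
    by - (rule iso_Comp_cancel[OF _ Lunit_iso[of Y]], simp_all)
qed

lemma Inv_Runit_nat:
  assumes [simp]: "f \<in> Arr M" "Dom M f = X" "Cod M f = Y"
  shows "Inv M (\<r> Y) \<cdot> f = (f \<boxtimes> \<iota> \<I>) \<cdot> Inv M (\<r> X)"
proof -
  have [simp]: "X \<in> Obj M" "Y \<in> Obj M"
    using Dom_in_Obj[of f] Cod_in_Obj[of f] by simp_all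
  show ?thesis
    using Comp_reduce[OF Runit_nat[of f], of "Inv M (\<r> X)"]
    by - (rule iso_Comp_cancel[OF _ Runit_iso[of Y]], simp_all)
qed

text \<open>By naturality of \<open>\<l>\<close>, the arrow
  \<open>\<iota> \<I> \<boxtimes> f\<close> determines \<open>f \<cdot> \<l> X\<close>, and
  \<open>\<l> X\<close> is invertible.\<close>

lemma Unit_Ten_faithful:
  assumes [simp]: "f \<in> Arr M" "g \<in> Arr M" "Dom M f = X" "Dom M g = X" "Cod M f = Y" "Cod M g = Y"
    and eq: "\<iota> \<I> \<boxtimes> f = \<iota> \<I> \<boxtimes> g"
  shows "f = g"
proof -
  have [simp]: "X \<in> Obj M" "Y \<in> Obj M"
    using Dom_in_Obj[of f] Cod_in_Obj[of f] by simp_all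
  have "f \<cdot> \<l> X = g \<cdot> \<l> X"
    using Lunit_nat[of f] Lunit_nat[of g] eq by simp
  then show ?thesis
    by - (rule Comp_iso_cancel[OF _ Lunit_iso[of X]], simp_all)
qed

lemma Ten_Unit_faithful:
  assumes [simp]: "f \<in> Arr M" "g \<in> Arr M" "Dom M f = X" "Dom M g = X" "Cod M f = Y" "Cod M g = Y"
    and eq: "f \<boxtimes> \<iota> \<I> = g \<boxtimes> \<iota> \<I>"
  shows "f = g"
proof -
  have [simp]: "X \<in> Obj M" "Y \<in> Obj M"
    using Dom_in_Obj[of f] Cod_in_Obj[of f] by simp_all
  have "f \<cdot> \<r> X = g \<cdot> \<r> X"
    using Runit_nat[of f] Runit_nat[of g] eq by simp
  then show ?thesis
    by - (rule Comp_iso_cancel[OF _ Runit_iso[of X]], simp_all)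
qed

lemma is_iso_Ten:
  assumes "is_iso M f" "is_iso M g"
  shows "is_iso M (f \<boxtimes> g)"
proof -
  note [simp] = Inv_simps[OF assms(1)] Inv_simps[OF assms(2)]
  have "inverse_arrows M (f \<boxtimes> g) (Inv M f \<boxtimes> Inv M g)"
    by (simp add: inverse_arrows_def Ten_merge HomI Ten_Ident Dom_in_Obj Cod_in_Obj)
  then show ?thesis
    by (auto simp: is_iso_def)
qed

lemma is_iso_Ident: "X \<in> Obj M \<Longrightarrow> is_iso M (\<iota> X)"
  by (auto simp: is_iso_def inverse_arrows_def intro!: exI[of _ "\<iota> X"] HomI)


text \<open>Kelly's derivation of the two unit coherences from the pentagon and the triangle:
  both sides are compared after tensoring with the unit object, which is faithful.\<close>

lemma Lunit_Ten:
  assumes [simp]: "X \<in> Obj M" "Y \<in> Obj M"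
  shows "\<l> (X \<boxdot> Y) \<cdot> \<a> \<I> X Y = \<l> X \<boxtimes> \<iota> Y"
proof (rule Unit_Ten_faithful[where X = "\<I> \<boxdot> X \<boxdot> Y" and Y = "X \<boxdot> Y"])
  \<comment> \<open>These are the first two arrows on the long side of the pentagon for
    \<open>\<I>\<close>, \<open>\<I>\<close>, \<open>X\<close>, \<open>Y\<close>. Appending them
    makes the pentagon and then the triangle applicable; both are invertible and are cancelled at
    the end.\<close>
  let ?a = "\<a> \<I> (\<I> \<boxdot> X) Y \<cdot> (\<a> \<I> \<I> X \<boxtimes> \<iota> Y)"
  have "(\<iota> \<I> \<boxtimes> (\<l> (X \<boxdot> Y) \<cdot> \<a> \<I> X Y)) \<cdot> ?a
      = (\<iota> \<I> \<boxtimes> \<l> (X \<boxdot> Y)) \<cdot> (\<iota> \<I> \<boxtimes> \<a> \<I> X Y) \<cdot> ?a"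
    by (simp add: Ten_Comp_merge_reduce)
  also have "\<dots> = (\<r> \<I> \<boxtimes> \<iota> (X \<boxdot> Y)) \<cdot> \<a> (\<I> \<boxdot> \<I>) X Y"
    using pentagon[of \<I> \<I> X Y] Comp_reduce[OF triangle[of \<I> "X \<boxdot> Y"], of "\<a> (\<I> \<boxdot> \<I>) X Y"]
    by simp
  also have "\<dots> = \<a> \<I> X Y \<cdot> ((\<r> \<I> \<boxtimes> \<iota> X) \<boxtimes> \<iota> Y)"
    using Assoc_nat[of "\<r> \<I>" "\<iota> X" "\<iota> Y"] by simp
  also have "\<dots> = \<a> \<I> X Y \<cdot> ((\<iota> \<I> \<boxtimes> \<l> X) \<boxtimes> \<iota> Y) \<cdot> (\<a> \<I> \<I> X \<boxtimes> \<iota> Y)"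
    using triangle[of \<I> X] by (simp add: Ten_merge)
  also have "\<dots> = (\<iota> \<I> \<boxtimes> (\<l> X \<boxtimes> \<iota> Y)) \<cdot> ?a"
    using Comp_reduce[OF Assoc_nat[of "\<iota> \<I>" "\<l> X" "\<iota> Y"], of "\<a> \<I> \<I> X \<boxtimes> \<iota> Y"] by simp
  finally have "(\<iota> \<I> \<boxtimes> (\<l> (X \<boxdot> Y) \<cdot> \<a> \<I> X Y)) \<cdot> \<a> \<I> (\<I> \<boxdot> X) Y \<cdot> (\<a> \<I> \<I> X \<boxtimes> \<iota> Y)
      = (\<iota> \<I> \<boxtimes> (\<l> X \<boxtimes> \<iota> Y)) \<cdot> \<a> \<I> (\<I> \<boxdot> X) Y \<cdot> (\<a> \<I> \<I> X \<boxtimes> \<iota> Y)" .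
  then have "(\<iota> \<I> \<boxtimes> (\<l> (X \<boxdot> Y) \<cdot> \<a> \<I> X Y)) \<cdot> \<a> \<I> (\<I> \<boxdot> X) Y
      = (\<iota> \<I> \<boxtimes> (\<l> X \<boxtimes> \<iota> Y)) \<cdot> \<a> \<I> (\<I> \<boxdot> X) Y"
    by - (rule Comp_iso_cancel[OF _ is_iso_Ten[OF Assoc_iso[of \<I> \<I> X] is_iso_Ident[of Y]]], simp_all)
  then show "\<iota> \<I> \<boxtimes> (\<l> (X \<boxdot> Y) \<cdot> \<a> \<I> X Y) = \<iota> \<I> \<boxtimes> (\<l> X \<boxtimes> \<iota> Y)"
    by - (rule Comp_iso_cancel[OF _ Assoc_iso[of \<I> "\<I> \<boxdot> X" Y]], simp_all)
qed simp_all

lemma Runit_Ten: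
  assumes [simp]: "X \<in> Obj M" "Y \<in> Obj M"
  shows "(\<iota> X \<boxtimes> \<r> Y) \<cdot> \<a> X Y \<I> = \<r> (X \<boxdot> Y)"
proof (rule Ten_Unit_faithful[where X = "X \<boxdot> Y \<boxdot> \<I>" and Y = "X \<boxdot> Y"])
  \<comment> \<open>The mirror argument: the triangle at \<open>X \<boxdot> Y\<close> and
    \<open>\<I>\<close>, the pentagon for \<open>X\<close>, \<open>Y\<close>, \<open>\<I>\<close>,
    \<open>\<I>\<close>, and the triangle at \<open>Y\<close> and \<open>\<I>\<close>. Here the
    auxiliary invertible arrow \<open>\<a> X Y \<I>\<close> stands on the left.\<close>
  have "\<a> X Y \<I> \<cdot> (\<r> (X \<boxdot> Y) \<boxtimes> \<iota> \<I>) = \<a> X Y \<I> \<cdot> ((\<iota> X \<boxtimes> \<iota> Y) \<boxtimes> \<l> \<I>) \<cdot> \<a> (X \<boxdot> Y) \<I> \<I>"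
    using triangle[of "X \<boxdot> Y" \<I>] by simp
  also have "\<dots> = (\<iota> X \<boxtimes> (\<iota> Y \<boxtimes> \<l> \<I>)) \<cdot> \<a> X Y (\<I> \<boxdot> \<I>) \<cdot> \<a> (X \<boxdot> Y) \<I> \<I>"
    using Comp_reduce[OF Assoc_nat[of "\<iota> X" "\<iota> Y" "\<l> \<I>"], of "\<a> (X \<boxdot> Y) \<I> \<I>"]
    by simp
  also have "\<dots> = (\<iota> X \<boxtimes> (\<iota> Y \<boxtimes> \<l> \<I>)) \<cdot> (\<iota> X \<boxtimes> \<a> Y \<I> \<I>) \<cdot> \<a> X (Y \<boxdot> \<I>) \<I> \<cdot> (\<a> X Y \<I> \<boxtimes> \<iota> \<I>)"
    using pentagon[of X Y \<I> \<I>] by simp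
  also have "\<dots> = (\<iota> X \<boxtimes> (\<r> Y \<boxtimes> \<iota> \<I>)) \<cdot> \<a> X (Y \<boxdot> \<I>) \<I> \<cdot> (\<a> X Y \<I> \<boxtimes> \<iota> \<I>)"
    using triangle[of Y \<I>] by (simp add: Ten_Comp_merge_reduce)
  also have "\<dots> = \<a> X Y \<I> \<cdot> ((\<iota> X \<boxtimes> \<r> Y) \<boxtimes> \<iota> \<I>) \<cdot> (\<a> X Y \<I> \<boxtimes> \<iota> \<I>)"
    using Comp_reduce[OF Assoc_nat[of "\<iota> X" "\<r> Y" "\<iota> \<I>"], of "\<a> X Y \<I> \<boxtimes> \<iota> \<I>"] by simp
  finally have "\<a> X Y \<I> \<cdot> (\<r> (X \<boxdot> Y) \<boxtimes> \<iota> \<I>) = \<a> X Y \<I> \<cdot> (((\<iota> X \<boxtimes> \<r> Y) \<cdot> \<a> X Y \<I>) \<boxtimes> \<iota> \<I>)"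
    by (simp add: Ten_merge)
  then show "((\<iota> X \<boxtimes> \<r> Y) \<cdot> \<a> X Y \<I>) \<boxtimes> \<iota> \<I> = \<r> (X \<boxdot> Y) \<boxtimes> \<iota> \<I>"
    by - (rule iso_Comp_cancel[OF _ Assoc_iso[of X Y \<I>]], simp_all)
qed simp_all

subsection \<open>Braidings\<close>

lemma braid_simps [simp]:
  assumes "A \<in> Obj M" "c \<in> Arr M" "Dom M c = A \<boxdot> A" "Cod M c = A \<boxdot> A"
  shows "braid12 M A c \<in> Arr M" "Dom M (braid12 M A c) = A \<boxdot> A \<boxdot> A"
    "Cod M (braid12 M A c) = A \<boxdot> A \<boxdot> A"
    "braid23 M A c \<in> Arr M" "Dom M (braid23 M A c) = A \<boxdot> A \<boxdot> A"
    "Cod M (braid23 M A c) = A \<boxdot> A \<boxdot> A"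
  using assms by (auto simp: braid12_def braid23_def)

lemma braid_inverse:
  assumes [simp]: "A \<in> Obj M" "c \<in> Arr M" "Dom M c = A \<boxdot> A" "Cod M c = A \<boxdot> A"
    "d \<in> Arr M" "Dom M d = A \<boxdot> A" "Cod M d = A \<boxdot> A"
    and "d \<cdot> c = \<iota> (A \<boxdot> A)"
  shows "braid12 M A d \<cdot> braid12 M A c = \<iota> (A \<boxdot> A \<boxdot> A)"
    "braid23 M A d \<cdot> braid23 M A c = \<iota> (A \<boxdot> A \<boxdot> A)"
  using assms(8) by (simp_all add: braid12_def braid23_def Ten_merge)

text \<open>The two compatibilities of a braiding with a comultiplication, for any arrow
  \<open>t : A \<rightarrow> A \<otimes> A\<close>, so that they can also be stated for the other arrow of the pair defining
  the primitive part.\<close>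

definition slides :: "'o \<Rightarrow> 'm \<Rightarrow> 'm \<Rightarrow> bool" where
  "slides A c t \<longleftrightarrow>
     (t \<boxtimes> \<iota> A) \<cdot> c = braid23 M A c \<cdot> braid12 M A c \<cdot> Inv M (\<a> A A A) \<cdot> (\<iota> A \<boxtimes> t) \<and>
     Inv M (\<a> A A A) \<cdot> (\<iota> A \<boxtimes> t) \<cdot> c = braid12 M A c \<cdot> braid23 M A c \<cdot> (t \<boxtimes> \<iota> A)"

text \<open>Composing an identity for \<open>c\<close> with \<open>d\<close> on the right and with
  the threefold extensions of \<open>d\<close> on the left gives the other identity for
  \<open>d\<close>. Inversion thus exchanges the two halves of \<open>slides\<close>, so both are
  carried along.\<close>

lemma slides_inverse:
  assumes c: "c \<in> Hom M (A \<boxdot> A) (A \<boxdot> A)" and d: "d \<in> Hom M (A \<boxdot> A) (A \<boxdot> A)"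
    and t: "t \<in> Hom M A (A \<boxdot> A)"
    and dc: "d \<cdot> c = \<iota> (A \<boxdot> A)" and cd: "c \<cdot> d = \<iota> (A \<boxdot> A)" and "slides A c t"
  shows "slides A d t"
proof -
  let ?c1 = "braid12 M A c" and ?c2 = "braid23 M A c"
    and ?d1 = "braid12 M A d" and ?d2 = "braid23 M A d"
    and ?t1 = "t \<boxtimes> \<iota> A" and ?t2 = "Inv M (\<a> A A A) \<cdot> (\<iota> A \<boxtimes> t)"
  note [simp] = HomD[OF c] HomD[OF d] HomD[OF t]
  have t1: "?t1 \<cdot> c = ?c2 \<cdot> ?c1 \<cdot> ?t2" and t2: "?t2 \<cdot> c = ?c1 \<cdot> ?c2 \<cdot> ?t1"
    using \<open>slides A c t\<close> by (simp_all add: slides_def)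
  note inv = braid_inverse[of A c d, simplified, OF dc]
  note reduce = Comp_reduce[OF inv(1), simplified] Comp_reduce[OF inv(2), simplified]
  have "?d1 \<cdot> ?d2 \<cdot> ?t1 = ?d1 \<cdot> ?d2 \<cdot> (?t1 \<cdot> c) \<cdot> d"
    by (simp add: cd)
  also have "\<dots> = ?t2 \<cdot> d"
    unfolding t1 by (simp add: reduce)
  finally have 1: "?d1 \<cdot> ?d2 \<cdot> ?t1 = ?t2 \<cdot> d" .
  have "?d2 \<cdot> ?d1 \<cdot> ?t2 = ?d2 \<cdot> ?d1 \<cdot> (?t2 \<cdot> c) \<cdot> d"
    by (simp add: cd)
  also have "\<dots> = ?t1 \<cdot> d"
    unfolding t2 by (simp add: reduce)
  finally have 2: "?d2 \<cdot> ?d1 \<cdot> ?t2 = ?t1 \<cdot> d" .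
  show ?thesis
    using 1 2 by (simp add: slides_def)
qed

text \<open>Below, \<open>q\<close> inserts the unit to the right of \<open>A\<close> and
  \<open>p\<close> to its left; the unit axioms say that \<open>c\<close> interchanges them. They
  are treated together because each of the four identities passes from one insertion to the
  other.\<close>

lemma slides_units:
  assumes u: "u \<in> Hom M \<I> A" and c: "c \<in> Hom M (A \<boxdot> A) (A \<boxdot> A)"
    and cl: "c \<cdot> (u \<boxtimes> \<iota> A) \<cdot> Inv M (\<l> A) = (\<iota> A \<boxtimes> u) \<cdot> Inv M (\<r> A)"
    and cr: "c \<cdot> (\<iota> A \<boxtimes> u) \<cdot> Inv M (\<r> A) = (u \<boxtimes> \<iota> A) \<cdot> Inv M (\<l> A)"
  shows "slides A c ((\<iota> A \<boxtimes> u) \<cdot> Inv M (\<r> A))" "slides A c ((u \<boxtimes> \<iota> A) \<cdot> Inv M (\<l> A))"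
proof -
  note [simp] = HomD[OF u] HomD[OF c]
  define q where "q = (\<iota> A \<boxtimes> u) \<cdot> Inv M (\<r> A)"
  define p where "p = (u \<boxtimes> \<iota> A) \<cdot> Inv M (\<l> A)"
  have [simp]: "q \<in> Arr M" "Dom M q = A" "Cod M q = A \<boxdot> A"
    "p \<in> Arr M" "Dom M p = A" "Cod M p = A \<boxdot> A"
    by (simp_all add: q_def p_def)
  let ?c1 = "braid12 M A c" and ?c2 = "braid23 M A c" and ?b = "Inv M (\<a> A A A)"
  have c1: "?c1 \<cdot> (p \<boxtimes> \<iota> A) = q \<boxtimes> \<iota> A" "?c1 \<cdot> (q \<boxtimes> \<iota> A) = p \<boxtimes> \<iota> A"
    using cl cr by (simp_all add: braid12_def Ten_merge flip: p_def q_def)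
  have c2: "?c2 \<cdot> ?b \<cdot> (\<iota> A \<boxtimes> p) = ?b \<cdot> (\<iota> A \<boxtimes> q)" "?c2 \<cdot> ?b \<cdot> (\<iota> A \<boxtimes> q) = ?b \<cdot> (\<iota> A \<boxtimes> p)"
    using cl cr by (simp_all add: braid23_def Ten_merge flip: p_def q_def)
  \<comment> \<open>A unit inserted between two factors may be attached to either of them; this is
    the triangle identity together with naturality of \<open>\<a>\<close>.\<close>
  have mid: "?b \<cdot> (\<iota> A \<boxtimes> p) = q \<boxtimes> \<iota> A"
  proof -
    have "(\<iota> A \<boxtimes> Inv M (\<l> A)) = \<a> A \<I> A \<cdot> (Inv M (\<r> A) \<boxtimes> \<iota> A)"
    proof (rule iso_Comp_cancel[OF _ is_iso_Ten[OF is_iso_Ident[of A] Lunit_iso[of A]]])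
      show "(\<iota> A \<boxtimes> \<l> A) \<cdot> (\<iota> A \<boxtimes> Inv M (\<l> A)) = (\<iota> A \<boxtimes> \<l> A) \<cdot> \<a> A \<I> A \<cdot> (Inv M (\<r> A) \<boxtimes> \<iota> A)"
        using Comp_reduce[OF triangle[of A A], of "Inv M (\<r> A) \<boxtimes> \<iota> A"] by (simp add: Ten_merge)
    qed simp_all
    then have "\<iota> A \<boxtimes> p = (\<iota> A \<boxtimes> (u \<boxtimes> \<iota> A)) \<cdot> \<a> A \<I> A \<cdot> (Inv M (\<r> A) \<boxtimes> \<iota> A)"
      using Ten_Comp_merge[of "\<iota> A" "\<iota> A" "Inv M (\<l> A)" "u \<boxtimes> \<iota> A"] by (simp add: p_def)
    also have "\<dots> = \<a> A A A \<cdot> ((\<iota> A \<boxtimes> u) \<boxtimes> \<iota> A) \<cdot> (Inv M (\<r> A) \<boxtimes> \<iota> A)"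
      using Comp_reduce[OF Assoc_nat[of "\<iota> A" u "\<iota> A"], of "Inv M (\<r> A) \<boxtimes> \<iota> A"] by simp
    also have "\<dots> = \<a> A A A \<cdot> (q \<boxtimes> \<iota> A)"
      by (simp add: q_def Ten_merge)
    finally show ?thesis by simp
  qed
  \<comment> \<open>A unit inserted at the far right does not interact with \<open>c\<close> on the
    first two factors. The coherence \<open>Runit_Ten\<close> rewrites the insertion through
    \<open>\<r> (A \<boxdot> A)\<close>, whose inverse is natural.\<close>
  have right: "?b \<cdot> (\<iota> A \<boxtimes> q) \<cdot> c = ?c1 \<cdot> ?b \<cdot> (\<iota> A \<boxtimes> q)"
  proof -
    have r: "?b \<cdot> (\<iota> A \<boxtimes> q) = (\<iota> (A \<boxdot> A) \<boxtimes> u) \<cdot> Inv M (\<r> (A \<boxdot> A))"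
    proof -
      have "Inv M (\<a> A A \<I>) \<cdot> (\<iota> A \<boxtimes> Inv M (\<r> A)) = Inv M (\<r> (A \<boxdot> A))"
      proof (rule iso_Comp_cancel[OF _ Runit_iso[of "A \<boxdot> A"]])
        have "\<r> (A \<boxdot> A) \<cdot> Inv M (\<a> A A \<I>) = \<iota> A \<boxtimes> \<r> A"
          by (simp flip: Runit_Ten)
        from Comp_reduce[OF this, of "\<iota> A \<boxtimes> Inv M (\<r> A)"]
        show "\<r> (A \<boxdot> A) \<cdot> Inv M (\<a> A A \<I>) \<cdot> (\<iota> A \<boxtimes> Inv M (\<r> A)) = \<r> (A \<boxdot> A) \<cdot> Inv M (\<r> (A \<boxdot> A))"
          by (simp add: Ten_merge)
      qed simp_all
      then have "(\<iota> (A \<boxdot> A) \<boxtimes> u) \<cdot> Inv M (\<r> (A \<boxdot> A))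
          = ((\<iota> A \<boxtimes> \<iota> A) \<boxtimes> u) \<cdot> Inv M (\<a> A A \<I>) \<cdot> (\<iota> A \<boxtimes> Inv M (\<r> A))"
        by simp
      also have "\<dots> = ?b \<cdot> (\<iota> A \<boxtimes> (\<iota> A \<boxtimes> u)) \<cdot> (\<iota> A \<boxtimes> Inv M (\<r> A))"
        using Comp_reduce[OF Inv_Assoc_nat[of "\<iota> A" "\<iota> A" u], of "\<iota> A \<boxtimes> Inv M (\<r> A)"] by simp
      finally show ?thesis
        by (simp add: q_def Ten_merge)
    qed
    have "((\<iota> (A \<boxdot> A) \<boxtimes> u) \<cdot> Inv M (\<r> (A \<boxdot> A))) \<cdot> c
        = (\<iota> (A \<boxdot> A) \<boxtimes> u) \<cdot> (c \<boxtimes> \<iota> \<I>) \<cdot> Inv M (\<r> (A \<boxdot> A))"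
      using Inv_Runit_nat[of c "A \<boxdot> A" "A \<boxdot> A"] by simp
    also have "\<dots> = ?c1 \<cdot> (\<iota> (A \<boxdot> A) \<boxtimes> u) \<cdot> Inv M (\<r> (A \<boxdot> A))"
      by (simp add: braid12_def Ten_merge)
    finally show ?thesis
      by (simp flip: r)
  qed
  \<comment> \<open>The mirror image at the far left, through \<open>Lunit_Ten\<close>.\<close>
  have left: "(p \<boxtimes> \<iota> A) \<cdot> c = ?c2 \<cdot> (p \<boxtimes> \<iota> A)"
  proof -
    have l: "\<a> A A A \<cdot> (p \<boxtimes> \<iota> A) = (u \<boxtimes> \<iota> (A \<boxdot> A)) \<cdot> Inv M (\<l> (A \<boxdot> A))"
    proof -
      have "\<a> \<I> A A \<cdot> (Inv M (\<l> A) \<boxtimes> \<iota> A) = Inv M (\<l> (A \<boxdot> A))"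
      proof (rule iso_Comp_cancel[OF _ Lunit_iso[of "A \<boxdot> A"]])
        show "\<l> (A \<boxdot> A) \<cdot> \<a> \<I> A A \<cdot> (Inv M (\<l> A) \<boxtimes> \<iota> A) = \<l> (A \<boxdot> A) \<cdot> Inv M (\<l> (A \<boxdot> A))"
          using Comp_reduce[OF Lunit_Ten[of A A], of "Inv M (\<l> A) \<boxtimes> \<iota> A"]
          by (simp add: Ten_merge)
      qed simp_all
      then have "(u \<boxtimes> \<iota> (A \<boxdot> A)) \<cdot> Inv M (\<l> (A \<boxdot> A))
          = (u \<boxtimes> (\<iota> A \<boxtimes> \<iota> A)) \<cdot> \<a> \<I> A A \<cdot> (Inv M (\<l> A) \<boxtimes> \<iota> A)"
        by simp
      also have "\<dots> = \<a> A A A \<cdot> ((u \<boxtimes> \<iota> A) \<boxtimes> \<iota> A) \<cdot> (Inv M (\<l> A) \<boxtimes> \<iota> A)"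
        using Comp_reduce[OF Assoc_nat[of u "\<iota> A" "\<iota> A"], of "Inv M (\<l> A) \<boxtimes> \<iota> A"] by simp
      finally show ?thesis
        by (simp add: p_def Ten_merge)
    qed
    have "\<a> A A A \<cdot> (p \<boxtimes> \<iota> A) \<cdot> c
        = ((u \<boxtimes> \<iota> (A \<boxdot> A)) \<cdot> Inv M (\<l> (A \<boxdot> A))) \<cdot> c"
      by (simp flip: l)
    also have "\<dots> = (u \<boxtimes> \<iota> (A \<boxdot> A)) \<cdot> (\<iota> \<I> \<boxtimes> c) \<cdot> Inv M (\<l> (A \<boxdot> A))"
      using Inv_Lunit_nat[of c "A \<boxdot> A" "A \<boxdot> A"] by simp
    also have "\<dots> = (\<iota> A \<boxtimes> c) \<cdot> (u \<boxtimes> \<iota> (A \<boxdot> A)) \<cdot> Inv M (\<l> (A \<boxdot> A))"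
      by (simp add: Ten_merge)
    also have "\<dots> = \<a> A A A \<cdot> ?c2 \<cdot> (p \<boxtimes> \<iota> A)"
      by (simp add: braid23_def flip: l)
    finally show ?thesis
      by - (rule iso_Comp_cancel[OF _ Assoc_iso[of A A A]], simp_all)
  qed
  \<comment> \<open>By \<open>right\<close> the insertion passes \<open>c\<close>, and
    \<open>?c2\<close> then takes the unit from the right end to the middle. The other three
    identities likewise combine one such move with \<open>right\<close> or
    \<open>left\<close>.\<close>
  have "(q \<boxtimes> \<iota> A) \<cdot> c = ?c2 \<cdot> ?c1 \<cdot> ?b \<cdot> (\<iota> A \<boxtimes> q)"
  proof -
    have "?c2 \<cdot> ?c1 \<cdot> ?b \<cdot> (\<iota> A \<boxtimes> q) = (?c2 \<cdot> ?b \<cdot> (\<iota> A \<boxtimes> q)) \<cdot> c"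
      by (simp flip: right)
    also have "\<dots> = (?b \<cdot> (\<iota> A \<boxtimes> p)) \<cdot> c"
      by (simp only: c2)
    finally show ?thesis
      by (simp only: mid)
  qed
  moreover have "?b \<cdot> (\<iota> A \<boxtimes> q) \<cdot> c = ?c1 \<cdot> ?c2 \<cdot> (q \<boxtimes> \<iota> A)"
    by (simp add: right c2 flip: mid)
  moreover have "(p \<boxtimes> \<iota> A) \<cdot> c = ?c2 \<cdot> ?c1 \<cdot> ?b \<cdot> (\<iota> A \<boxtimes> p)"
    by (simp add: mid c1 left)
  moreover have "?b \<cdot> (\<iota> A \<boxtimes> p) \<cdot> c = ?c1 \<cdot> ?c2 \<cdot> (p \<boxtimes> \<iota> A)"
  proof -
    have "?c1 \<cdot> ?c2 \<cdot> (p \<boxtimes> \<iota> A) = (?c1 \<cdot> (p \<boxtimes> \<iota> A)) \<cdot> c"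
      by (simp flip: left)
    also have "\<dots> = (?b \<cdot> (\<iota> A \<boxtimes> p)) \<cdot> c"
      by (simp only: c1 mid)
    finally show ?thesis
      by simp
  qed
  ultimately show "slides A c ((\<iota> A \<boxtimes> u) \<cdot> Inv M (\<r> A))" "slides A c ((u \<boxtimes> \<iota> A) \<cdot> Inv M (\<l> A))"
    by (simp_all only: slides_def flip: p_def q_def)
qed

section \<open>Restriction of a braiding along a monomorphism\<close>

lemma braid_intertwine:
  assumes e: "e \<in> Hom M E A" and c: "c \<in> Hom M (A \<boxdot> A) (A \<boxdot> A)"
    and k: "k \<in> Hom M (E \<boxdot> E) (E \<boxdot> E)"
    and eq: "(e \<boxtimes> e) \<cdot> k = c \<cdot> (e \<boxtimes> e)"
  shows "(e \<boxtimes> e \<boxtimes> e) \<cdot> braid12 M E k = braid12 M A c \<cdot> (e \<boxtimes> e \<boxtimes> e)"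
    "(e \<boxtimes> e \<boxtimes> e) \<cdot> braid23 M E k = braid23 M A c \<cdot> (e \<boxtimes> e \<boxtimes> e)"
proof -
  note [simp] = HomD[OF e] HomD[OF c] HomD[OF k]
  show "(e \<boxtimes> e \<boxtimes> e) \<cdot> braid12 M E k = braid12 M A c \<cdot> (e \<boxtimes> e \<boxtimes> e)"
    using eq by (simp add: braid12_def Ten_merge)
  \<comment> \<open>Naturality of \<open>\<a>\<close> and its inverse carries the cube of
    \<open>e\<close> across the rebracketing, between which the braiding acts on the last two
    factors.\<close>
  have "(e \<boxtimes> e \<boxtimes> e) \<cdot> braid23 M E k
      = ((e \<boxtimes> e \<boxtimes> e) \<cdot> Inv M (\<a> E E E)) \<cdot> (\<iota> E \<boxtimes> k) \<cdot> \<a> E E E"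
    by (simp add: braid23_def)
  also have "\<dots> = Inv M (\<a> A A A) \<cdot> (e \<boxtimes> (e \<boxtimes> e)) \<cdot> (\<iota> E \<boxtimes> k) \<cdot> \<a> E E E"
    using Inv_Assoc_nat[of e e e] by (simp flip: Comp_assoc_simp)
  also have "\<dots> = Inv M (\<a> A A A) \<cdot> (\<iota> A \<boxtimes> c) \<cdot> (e \<boxtimes> (e \<boxtimes> e)) \<cdot> \<a> E E E"
    using eq by (simp add: Ten_merge)
  also have "\<dots> = braid23 M A c \<cdot> (e \<boxtimes> e \<boxtimes> e)"
    using Assoc_nat[of e e e] by (simp add: braid23_def)
  finally show "(e \<boxtimes> e \<boxtimes> e) \<cdot> braid23 M E k = braid23 M A c \<cdot> (e \<boxtimes> e \<boxtimes> e)" .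
qed

text \<open>Composed with the cube of \<open>e\<close>, both sides of the braid equation for
  \<open>k\<close> become those for \<open>c\<close> preceded by the cube, and the cube is monic.
  Invertibility of \<open>k\<close> is supplied separately, by restricting the inverse of
  \<open>c\<close> as well.\<close>

lemma braided_object_pullback:
  assumes A: "braided_object M A c"
    and e: "e \<in> Hom M E A" and k: "k \<in> Hom M (E \<boxdot> E) (E \<boxdot> E)" and "is_iso M k"
    and eq: "(e \<boxtimes> e) \<cdot> k = c \<cdot> (e \<boxtimes> e)"
    and mono: "mono_arr (e \<boxtimes> e \<boxtimes> e)"
  shows "braided_object M E k"
proof -
  have c: "c \<in> Hom M (A \<boxdot> A) (A \<boxdot> A)"
    and braid: "braid12 M A c \<cdot> braid23 M A c \<cdot> braid12 M A c
      = braid23 M A c \<cdot> braid12 M A c \<cdot> braid23 M A c"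
    using A by (auto simp: braided_object_def)
  note [simp] = HomD[OF e] HomD[OF c] HomD[OF k]
  let ?T = "e \<boxtimes> e \<boxtimes> e"
    and ?k1 = "braid12 M E k" and ?k2 = "braid23 M E k"
    and ?c1 = "braid12 M A c" and ?c2 = "braid23 M A c"
  note T = braid_intertwine[OF e c k eq]
  note reduce = Comp_reduce[OF T(1), simplified] Comp_reduce[OF T(2), simplified]
  have "?T \<cdot> ?k1 \<cdot> ?k2 \<cdot> ?k1 = (?c1 \<cdot> ?c2 \<cdot> ?c1) \<cdot> ?T"
    by (simp add: T reduce)
  also have "\<dots> = ?T \<cdot> ?k2 \<cdot> ?k1 \<cdot> ?k2"
    unfolding braid by (simp add: T reduce)
  finally have "?k1 \<cdot> ?k2 \<cdot> ?k1 = ?k2 \<cdot> ?k1 \<cdot> ?k2"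
    by (rule mono_arrD[OF mono, of _ _ "E \<boxdot> E \<boxdot> E"]) (auto intro: HomI)
  then show ?thesis
    using k \<open>is_iso M k\<close> by (simp add: braided_object_def)
qed

end

section \<open>Exact tensor functors\<close>

locale exact_tensor_category = preadditive_monoidal_category +
  assumes additive_left: "X \<in> Obj M \<Longrightarrow> additive_functor M M (left_tensor_functor M X)"
    and additive_right: "X \<in> Obj M \<Longrightarrow> additive_functor M M (right_tensor_functor M X)"
    and exact_left: "X \<in> Obj M \<Longrightarrow> preserves_equalizers M M (left_tensor_functor M X)"
    and exact_right: "X \<in> Obj M \<Longrightarrow> preserves_equalizers M M (right_tensor_functor M X)"
begin

section \<open>Additivity of composition, tensor product and sliding\<close>

lemma Comp_Plus_right:
  assumes "f \<in> Hom M X Y" "f' \<in> Hom M X Y" "g \<in> Hom M Y Z"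
  shows "g \<cdot> (f \<boxplus> f') = (g \<cdot> f) \<boxplus> (g \<cdot> f')"
  using hom_mult[OF Comp_additive_right[OF assms(3) HomD(4)[OF assms(1)]], of f f'] assms
  by (simp add: Hom_group_def)

lemma Comp_Plus_left:
  assumes "g \<in> Hom M Y Z" "g' \<in> Hom M Y Z" "f \<in> Hom M X Y"
  shows "(g \<boxplus> g') \<cdot> f = (g \<cdot> f) \<boxplus> (g' \<cdot> f)"
  using hom_mult[OF Comp_additive_left[OF assms(3) HomD(5)[OF assms(1)]], of g g'] assms
  by (simp add: Hom_group_def)

lemma Ten_Plus:
  assumes f: "f \<in> Hom M Y Z" and g: "g \<in> Hom M Y Z" and X: "X \<in> Obj M"
  shows "\<iota> X \<boxtimes> (f \<boxplus> g) = (\<iota> X \<boxtimes> f) \<boxplus> (\<iota> X \<boxtimes> g)"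
    "(f \<boxplus> g) \<boxtimes> \<iota> X = (f \<boxtimes> \<iota> X) \<boxplus> (g \<boxtimes> \<iota> X)"
proof -
  have "on_arr (left_tensor_functor M X) \<in> hom (Hom_group M Y Z) (Hom_group M (X \<boxdot> Y) (X \<boxdot> Z))"
    "on_arr (right_tensor_functor M X) \<in> hom (Hom_group M Y Z) (Hom_group M (Y \<boxdot> X) (Z \<boxdot> X))"
    using additive_left[OF X] additive_right[OF X] HomD(4,5)[OF f]
    by (auto simp: additive_functor_def left_tensor_functor_def right_tensor_functor_def)
  from this[THEN hom_mult, of f g] f g
  show "\<iota> X \<boxtimes> (f \<boxplus> g) = (\<iota> X \<boxtimes> f) \<boxplus> (\<iota> X \<boxtimes> g)"
    "(f \<boxplus> g) \<boxtimes> \<iota> X = (f \<boxtimes> \<iota> X) \<boxplus> (g \<boxtimes> \<iota> X)"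
    by (simp_all add: Hom_group_def left_tensor_functor_def right_tensor_functor_def)
qed

text \<open>For fixed \<open>c\<close>, both sides of each identity in \<open>slides\<close> are
  additive in the third argument. The sum is pulled out through one factor at a time, innermost
  first.\<close>

lemma slides_Plus:
  assumes c: "c \<in> Hom M (A \<boxdot> A) (A \<boxdot> A)"
    and s: "s \<in> Hom M A (A \<boxdot> A)" and t: "t \<in> Hom M A (A \<boxdot> A)"
    and "slides A c s" "slides A c t"
  shows "slides A c (s \<boxplus> t)"
proof -
  note [simp] = HomD[OF c] HomD[OF s] HomD[OF t]
  let ?b = "Inv M (\<a> A A A)" and ?c1 = "braid12 M A c" and ?c2 = "braid23 M A c"
  have b: "?b \<in> Hom M (A \<boxdot> (A \<boxdot> A)) (A \<boxdot> A \<boxdot> A)"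
    and c1: "?c1 \<in> Hom M (A \<boxdot> A \<boxdot> A) (A \<boxdot> A \<boxdot> A)"
    and c2: "?c2 \<in> Hom M (A \<boxdot> A \<boxdot> A) (A \<boxdot> A \<boxdot> A)"
    by (auto intro: HomI)
  have l: "s \<boxtimes> \<iota> A \<in> Hom M (A \<boxdot> A) (A \<boxdot> A \<boxdot> A)" "t \<boxtimes> \<iota> A \<in> Hom M (A \<boxdot> A) (A \<boxdot> A \<boxdot> A)"
    and r: "\<iota> A \<boxtimes> s \<in> Hom M (A \<boxdot> A) (A \<boxdot> (A \<boxdot> A))" "\<iota> A \<boxtimes> t \<in> Hom M (A \<boxdot> A) (A \<boxdot> (A \<boxdot> A))"
    by (auto intro: HomI)
  note cl = Comp_Plus_left[OF l c] Comp_Plus_left[OF r c]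
  note b_r = Comp_Plus_right[OF r b]
  note br = Comp_in_Hom[OF r(1) b] Comp_in_Hom[OF r(2) b]
  note rc = Comp_in_Hom[OF c r(1)] Comp_in_Hom[OF c r(2)]
  have "?c2 \<cdot> ?c1 \<cdot> ?b \<cdot> ((\<iota> A \<boxtimes> s) \<boxplus> (\<iota> A \<boxtimes> t))
      = (?c2 \<cdot> ?c1 \<cdot> ?b \<cdot> (\<iota> A \<boxtimes> s)) \<boxplus> (?c2 \<cdot> ?c1 \<cdot> ?b \<cdot> (\<iota> A \<boxtimes> t))"
    unfolding b_r Comp_Plus_right[OF br c1]
    by (rule Comp_Plus_right[OF Comp_in_Hom[OF br(1) c1] Comp_in_Hom[OF br(2) c1] c2])
  moreover have "?c1 \<cdot> ?c2 \<cdot> ((s \<boxtimes> \<iota> A) \<boxplus> (t \<boxtimes> \<iota> A))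
      = (?c1 \<cdot> ?c2 \<cdot> (s \<boxtimes> \<iota> A)) \<boxplus> (?c1 \<cdot> ?c2 \<cdot> (t \<boxtimes> \<iota> A))"
    unfolding Comp_Plus_right[OF l c2]
    by (rule Comp_Plus_right[OF Comp_in_Hom[OF l(1) c2] Comp_in_Hom[OF l(2) c2] c1])
  moreover have "?b \<cdot> (((\<iota> A \<boxtimes> s) \<cdot> c) \<boxplus> ((\<iota> A \<boxtimes> t) \<cdot> c))
      = (?b \<cdot> (\<iota> A \<boxtimes> s) \<cdot> c) \<boxplus> (?b \<cdot> (\<iota> A \<boxtimes> t) \<cdot> c)"
    by (rule Comp_Plus_right[OF rc b])
  ultimately show ?thesis
    using assms(4,5) unfolding slides_def by (simp only: Ten_Plus[OF s t] HomD[OF c] HomD[OF s] cl)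
qed

section \<open>Equalizers under tensor functors\<close>

lemma equalizer_Ten:
  assumes "is_equalizer M p q E e" "X \<in> Obj M"
  shows "is_equalizer M (\<iota> X \<boxtimes> p) (\<iota> X \<boxtimes> q) (X \<boxdot> E) (\<iota> X \<boxtimes> e)"
    "is_equalizer M (p \<boxtimes> \<iota> X) (q \<boxtimes> \<iota> X) (E \<boxdot> X) (e \<boxtimes> \<iota> X)"
  using exact_left[OF assms(2)] exact_right[OF assms(2)] assms(1)
  by (auto simp: preserves_equalizers_def left_tensor_functor_def right_tensor_functor_def)

text \<open>The square and the cube of \<open>e\<close> are composites of arrows that apply
  \<open>e\<close> in a single tensor slot. Each of these is again an equalizer, hence
  monic.\<close>

lemma equalizer_cube_mono:
  assumes eq: "is_equalizer M p q E e" and e: "e \<in> Hom M E A"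
  shows "mono_arr (e \<boxtimes> e)" "mono_arr (e \<boxtimes> e \<boxtimes> e)"
proof -
  note [simp] = HomD[OF e]
  have "mono_arr ((e \<boxtimes> \<iota> A) \<cdot> (\<iota> E \<boxtimes> e))"
    by (intro mono_arr_Comp equalizer_mono[OF equalizer_Ten(1)[OF eq]]
        equalizer_mono[OF equalizer_Ten(2)[OF eq]]) simp_all
  then show "mono_arr (e \<boxtimes> e)"
    by (simp add: Ten_merge)
  have "mono_arr ((e \<boxtimes> \<iota> A \<boxtimes> \<iota> A) \<cdot> (\<iota> E \<boxtimes> e \<boxtimes> \<iota> A) \<cdot> (\<iota> (E \<boxdot> E) \<boxtimes> e))"
    by (intro mono_arr_Comp equalizer_mono[OF equalizer_Ten(1)[OF eq]]
        equalizer_mono[OF equalizer_Ten(2)[OF equalizer_Ten(1)[OF eq]]]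
        equalizer_mono[OF equalizer_Ten(2)[OF equalizer_Ten(2)[OF eq]]]) simp_all
  then show "mono_arr (e \<boxtimes> e \<boxtimes> e)"
    by (simp add: Ten_merge)
qed

text \<open>The subobjects \<open>E \<otimes> A\<close> and \<open>A \<otimes> E\<close> of \<open>A \<otimes> A\<close> intersect in \<open>E \<otimes> E\<close>.\<close>

lemma equalizer_square_factor:
  assumes eq: "is_equalizer M p q E e" and p: "p \<in> Hom M A B"
    and x: "x \<in> Hom M Z (A \<boxdot> E)" and y: "y \<in> Hom M Z (E \<boxdot> A)"
    and xy: "(\<iota> A \<boxtimes> e) \<cdot> x = (e \<boxtimes> \<iota> A) \<cdot> y"
  obtains z where "z \<in> Hom M Z (E \<boxdot> E)" "(e \<boxtimes> e) \<cdot> z = (\<iota> A \<boxtimes> e) \<cdot> x"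
proof -
  note e = equalizer_Hom[OF eq p]
  note [simp] = HomD[OF p] HomD[OF e(1)] HomD[OF e(3)] HomD(1-3)[OF x] HomD(1-3)[OF y]
  \<comment> \<open>The right-hand side sees \<open>f\<close> only through
    \<open>f \<cdot> e\<close>, so it is the same for \<open>p\<close> and \<open>q\<close>. Since
    \<open>\<iota> B \<boxtimes> e\<close> is monic, \<open>x\<close> equalizes
    \<open>p \<boxtimes> \<iota> E\<close> and \<open>q \<boxtimes> \<iota> E\<close>.\<close>
  have 1: "(\<iota> B \<boxtimes> e) \<cdot> (f \<boxtimes> \<iota> E) \<cdot> x = ((f \<cdot> e) \<boxtimes> \<iota> A) \<cdot> y" if f: "f \<in> Hom M A B" for f
  proof -
    note [simp] = HomD[OF f]
    have "(\<iota> B \<boxtimes> e) \<cdot> (f \<boxtimes> \<iota> E) \<cdot> x = (f \<boxtimes> \<iota> A) \<cdot> (\<iota> A \<boxtimes> e) \<cdot> x"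
      by (simp add: Ten_merge)
    also have "\<dots> = ((f \<cdot> e) \<boxtimes> \<iota> A) \<cdot> y"
      unfolding xy by (simp add: Ten_merge)
    finally show ?thesis .
  qed
  have "(p \<boxtimes> \<iota> E) \<cdot> x = (q \<boxtimes> \<iota> E) \<cdot> x"
    by (rule mono_arrD[OF equalizer_mono[OF equalizer_Ten(1)[OF eq, of B]], of _ _ Z])
       (use 1[OF p] 1[OF e(3)] e(2) in \<open>auto intro: HomI\<close>)
  moreover have "p \<boxtimes> \<iota> E \<in> Hom M (A \<boxdot> E) (B \<boxdot> E)"
    by (auto intro: HomI)
  ultimately obtain z where z: "z \<in> Hom M Z (E \<boxdot> E)" and "(e \<boxtimes> \<iota> E) \<cdot> z = x"
    using equalizer_factor[OF equalizer_Ten(2)[OF eq, of E] _ x] by (metis HomD(5)[OF y] e(1) HomD(4))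
  note [simp] = HomD(1-3)[OF z]
  have "(e \<boxtimes> e) \<cdot> z = (\<iota> A \<boxtimes> e) \<cdot> x"
    unfolding \<open>(e \<boxtimes> \<iota> E) \<cdot> z = x\<close>[symmetric] by (simp add: Ten_merge)
  then show thesis
    using that z by blast
qed

text \<open>Stated for an arbitrary endomorphism \<open>d\<close> along which both arrows of the
  pair slide, because it is applied to a braiding and to its inverse.\<close>

lemma slides_equalizer_factor:
  assumes eq: "is_equalizer M p q E e" and p: "p \<in> Hom M A (A \<boxdot> A)"
    and d: "d \<in> Hom M (A \<boxdot> A) (A \<boxdot> A)"
    and sp: "slides A d p" and sq: "slides A d q"
  obtains z where "z \<in> Hom M (E \<boxdot> E) (E \<boxdot> E)" "(e \<boxtimes> e) \<cdot> z = d \<cdot> (e \<boxtimes> e)"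
proof -
  note e = equalizer_Hom[OF eq p]
  note [simp] = HomD[OF p] HomD[OF e(1)] HomD[OF e(3)] HomD[OF d]
  let ?b = "Inv M (\<a> A A A)" and ?d1 = "braid12 M A d" and ?d2 = "braid23 M A d"
  \<comment> \<open>Sliding moves \<open>t\<close> next to \<open>e\<close>; the result depends on
    \<open>t \<cdot> e\<close> alone, which agrees for \<open>t = p\<close> and
    \<open>t = q\<close>.\<close>
  have r: "?b \<cdot> (\<iota> A \<boxtimes> t) \<cdot> d \<cdot> (e \<boxtimes> \<iota> A) = ?d1 \<cdot> ?d2 \<cdot> ((t \<cdot> e) \<boxtimes> \<iota> A)"
    and l: "(t \<boxtimes> \<iota> A) \<cdot> d \<cdot> (\<iota> A \<boxtimes> e) = ?d2 \<cdot> ?d1 \<cdot> ?b \<cdot> (\<iota> A \<boxtimes> (t \<cdot> e))"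
    if t: "t \<in> Hom M A (A \<boxdot> A)" and st: "slides A d t" for t
  proof -
    note [simp] = HomD[OF t]
    have "?b \<cdot> (\<iota> A \<boxtimes> t) \<cdot> d \<cdot> (e \<boxtimes> \<iota> A) = (?b \<cdot> (\<iota> A \<boxtimes> t) \<cdot> d) \<cdot> (e \<boxtimes> \<iota> A)"
      by simp
    also have "\<dots> = ?d1 \<cdot> ?d2 \<cdot> ((t \<cdot> e) \<boxtimes> \<iota> A)"
      \<comment> \<open>Reassociation is first switched off, so that the left side of the sliding
        identity stays visible as a subterm; the second call restores the normal form.\<close>
      using st by (simp add: slides_def Ten_merge del: Comp_assoc_simp) (simp add: Ten_merge)
    finally show "?b \<cdot> (\<iota> A \<boxtimes> t) \<cdot> d \<cdot> (e \<boxtimes> \<iota> A) = ?d1 \<cdot> ?d2 \<cdot> ((t \<cdot> e) \<boxtimes> \<iota> A)" .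
    have "(t \<boxtimes> \<iota> A) \<cdot> d \<cdot> (\<iota> A \<boxtimes> e) = ((t \<boxtimes> \<iota> A) \<cdot> d) \<cdot> (\<iota> A \<boxtimes> e)"
      by simp
    also have "\<dots> = ?d2 \<cdot> ?d1 \<cdot> ?b \<cdot> (\<iota> A \<boxtimes> (t \<cdot> e))"
      using st by (simp add: slides_def Ten_merge del: Comp_assoc_simp) (simp add: Ten_merge)
    finally show "(t \<boxtimes> \<iota> A) \<cdot> d \<cdot> (\<iota> A \<boxtimes> e) = ?d2 \<cdot> ?d1 \<cdot> ?b \<cdot> (\<iota> A \<boxtimes> (t \<cdot> e))" .
  qed
  have "?b \<cdot> (\<iota> A \<boxtimes> p) \<cdot> d \<cdot> (e \<boxtimes> \<iota> A) = ?b \<cdot> (\<iota> A \<boxtimes> q) \<cdot> d \<cdot> (e \<boxtimes> \<iota> A)"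
    using r[OF p sp] r[OF e(3) sq] e(2) by simp
  then have "\<a> A A A \<cdot> ?b \<cdot> (\<iota> A \<boxtimes> p) \<cdot> d \<cdot> (e \<boxtimes> \<iota> A) = \<a> A A A \<cdot> ?b \<cdot> (\<iota> A \<boxtimes> q) \<cdot> d \<cdot> (e \<boxtimes> \<iota> A)"
    by (simp only:)
  then have right: "(\<iota> A \<boxtimes> p) \<cdot> d \<cdot> (e \<boxtimes> \<iota> A) = (\<iota> A \<boxtimes> q) \<cdot> d \<cdot> (e \<boxtimes> \<iota> A)"
    by simp
  have left: "(p \<boxtimes> \<iota> A) \<cdot> d \<cdot> (\<iota> A \<boxtimes> e) = (q \<boxtimes> \<iota> A) \<cdot> d \<cdot> (\<iota> A \<boxtimes> e)"
    using l[OF p sp] l[OF e(3) sq] e(2) by simp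
  obtain x where x: "x \<in> Hom M (E \<boxdot> A) (A \<boxdot> E)" and ex: "(\<iota> A \<boxtimes> e) \<cdot> x = d \<cdot> (e \<boxtimes> \<iota> A)"
    by (rule equalizer_factor[OF equalizer_Ten(1)[OF eq, of A] _ _ right, of "A \<boxdot> A" "A \<boxdot> (A \<boxdot> A)" "E \<boxdot> A"])
       (auto intro: HomI)
  obtain y where y: "y \<in> Hom M (A \<boxdot> E) (E \<boxdot> A)" and ey: "(e \<boxtimes> \<iota> A) \<cdot> y = d \<cdot> (\<iota> A \<boxtimes> e)"
    by (rule equalizer_factor[OF equalizer_Ten(2)[OF eq, of A] _ _ left, of "A \<boxdot> A" "A \<boxdot> A \<boxdot> A" "A \<boxdot> E"])
       (auto intro: HomI)
  note [simp] = HomD(1-3)[OF x] HomD(1-3)[OF y]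
  \<comment> \<open>Restricted to \<open>E \<boxdot> E\<close>, the factorizations \<open>x\<close>
    and \<open>y\<close> both yield \<open>d \<cdot> (e \<boxtimes> e)\<close>, which therefore
    factors through the intersection of the two subobjects.\<close>
  have x': "(\<iota> A \<boxtimes> e) \<cdot> x \<cdot> (\<iota> E \<boxtimes> e) = d \<cdot> (e \<boxtimes> e)"
    using Comp_reduce[OF ex, of "\<iota> E \<boxtimes> e"] by (simp add: Ten_merge)
  moreover have "(e \<boxtimes> \<iota> A) \<cdot> y \<cdot> (e \<boxtimes> \<iota> E) = d \<cdot> (e \<boxtimes> e)"
    using Comp_reduce[OF ey, of "e \<boxtimes> \<iota> E"] by (simp add: Ten_merge)
  ultimately have "(\<iota> A \<boxtimes> e) \<cdot> x \<cdot> (\<iota> E \<boxtimes> e) = (e \<boxtimes> \<iota> A) \<cdot> y \<cdot> (e \<boxtimes> \<iota> E)"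
    by simp
  then obtain z where "z \<in> Hom M (E \<boxdot> E) (E \<boxdot> E)"
    "(e \<boxtimes> e) \<cdot> z = (\<iota> A \<boxtimes> e) \<cdot> x \<cdot> (\<iota> E \<boxtimes> e)"
    by (rule equalizer_square_factor[OF eq p, rotated 2]) (auto intro: HomI)
  then show thesis
    using that x' by simp
qed

text \<open>The braiding and its inverse both restrict to \<open>E \<boxdot> E\<close>; as
  \<open>e \<boxtimes> e\<close> is monic, the restrictions are inverse to each other.\<close>

lemma slides_equalizer_braided:
  assumes eq: "is_equalizer M p q E e" and p: "p \<in> Hom M A (A \<boxdot> A)"
    and A: "braided_object M A c"
    and sp: "slides A c p" and sq: "slides A c q"
  obtains k where "k \<in> Hom M (E \<boxdot> E) (E \<boxdot> E)" "(e \<boxtimes> e) \<cdot> k = c \<cdot> (e \<boxtimes> e)" "braided_object M E k"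
proof -
  note e = equalizer_Hom[OF eq p]
  have c: "c \<in> Hom M (A \<boxdot> A) (A \<boxdot> A)" and iso: "is_iso M c"
    using A by (auto simp: braided_object_def)
  let ?d = "Inv M c"
  note [simp] = HomD[OF p] HomD[OF e(1)] HomD[OF e(3)] HomD[OF c]
  note [simp] = Inv_simps[OF iso, simplified]
  have d: "?d \<in> Hom M (A \<boxdot> A) (A \<boxdot> A)"
    by (auto intro: HomI)
  have "slides A ?d p" "slides A ?d q"
    using slides_inverse[OF c d p] slides_inverse[OF c d e(3)] sp sq by simp_all
  then obtain l where l: "l \<in> Hom M (E \<boxdot> E) (E \<boxdot> E)" and el: "(e \<boxtimes> e) \<cdot> l = ?d \<cdot> (e \<boxtimes> e)"
    using slides_equalizer_factor[OF eq p d] by metis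
  obtain k where k: "k \<in> Hom M (E \<boxdot> E) (E \<boxdot> E)" and ek: "(e \<boxtimes> e) \<cdot> k = c \<cdot> (e \<boxtimes> e)"
    using slides_equalizer_factor[OF eq p c sp sq] by metis
  note [simp] = HomD(1-3)[OF l] HomD(1-3)[OF k]
  note mono = equalizer_cube_mono[OF eq e(1)]
  have "k \<cdot> l = \<iota> (E \<boxdot> E)"
    by (rule mono_arrD[OF mono(1), of _ _ "E \<boxdot> E"])
       (auto simp: el Comp_reduce[OF ek, of l] intro!: HomI)
  moreover have "l \<cdot> k = \<iota> (E \<boxdot> E)"
    by (rule mono_arrD[OF mono(1), of _ _ "E \<boxdot> E"])
       (auto simp: ek Comp_reduce[OF el, of k] intro!: HomI)
  ultimately have "is_iso M k"
    using l by (auto simp: is_iso_def inverse_arrows_def)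
  then show thesis
    using that k ek braided_object_pullback[OF A e(1) k _ ek mono(2)] by blast
qed

subsection \<open>Primitive parts\<close>

lemma BrBialg_ObjD:
  assumes "A \<in> Obj (BrBialg M)"
  shows "base A \<in> Obj M" "unt A \<in> Hom M \<I> (base A)"
    "comul A \<in> Hom M (base A) (base A \<boxdot> base A)"
    "braided_object M (base A) (braid A)" "braid A \<in> Hom M (base A \<boxdot> base A) (base A \<boxdot> base A)"
    "slides (base A) (braid A) (comul A)"
  using assms
  by (auto simp: BrBialg_def structured_category_def braided_bialgebra_def braided_algebra_def
      braided_coalgebra_def monoidal_algebra_def monoidal_coalgebra_def braided_object_def slides_def)

lemma primitive_summands_in_Hom:
  assumes "A \<in> Obj (BrBialg M)"
  shows "(\<iota> (base A) \<boxtimes> unt A) \<cdot> Inv M (\<r> (base A)) \<in> Hom M (base A) (base A \<boxdot> base A)"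
    "(unt A \<boxtimes> \<iota> (base A)) \<cdot> Inv M (\<l> (base A)) \<in> Hom M (base A) (base A \<boxdot> base A)"
  using HomD[OF BrBialg_ObjD(2)[OF assms]] by (auto intro!: HomI)

text \<open>Each summand slides by the unit axioms of a braided algebra, and sliding is
  additive.\<close>

lemma slides_primitive_target:
  assumes A: "A \<in> Obj (BrBialg M)"
  shows "slides (base A) (braid A) (primitive_target M A)"
  unfolding primitive_target_def
proof (intro slides_Plus[OF BrBialg_ObjD(5)[OF A] primitive_summands_in_Hom[OF A]]
    slides_units[OF BrBialg_ObjD(2,5)[OF A]])
qed (use A in \<open>auto simp: BrBialg_def structured_category_def braided_bialgebra_def braided_algebra_def\<close>)

lemma BrBialg_HomD:
  assumes "f \<in> Hom (BrBialg M) A A'"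
  shows "A \<in> Obj (BrBialg M)" "A' \<in> Obj (BrBialg M)" "sarr_dom f = A" "sarr_cod f = A'"
    "sarr f \<in> Hom M (base A) (base A')" "sarr f \<cdot> unt A = unt A'"
    "comul A' \<cdot> sarr f = (sarr f \<boxtimes> sarr f) \<cdot> comul A"
    "braided_object_morphism M (base A) (braid A) (base A') (braid A') (sarr f)"
  using assms
  by (auto simp: Hom_def BrBialg_def structured_category_def br_bialg_mor_def br_alg_mor_def
      br_obj_mor_def monoidal_algebra_morphism_def monoidal_coalgebra_morphism_def)

text \<open>The morphism preserves the unit, so naturality of the inverse unit constraints handles
  each summand; additivity of composition handles the sum.\<close>

lemma primitive_target_natural:
  assumes f: "f \<in> Hom (BrBialg M) A A'"
  shows "primitive_target M A' \<cdot> sarr f = (sarr f \<boxtimes> sarr f) \<cdot> primitive_target M A"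
proof -
  let ?f = "sarr f"
  note F = BrBialg_HomD[OF f]
  note u = BrBialg_ObjD(2)[OF F(1)] and u' = BrBialg_ObjD(2)[OF F(2)]
  note [simp] = HomD[OF F(5)] HomD[OF u] HomD[OF u']
  note q = primitive_summands_in_Hom[OF F(1)] and q' = primitive_summands_in_Hom[OF F(2)]
  have ff: "?f \<boxtimes> ?f \<in> Hom M (base A \<boxdot> base A) (base A' \<boxdot> base A')"
    by (auto intro: HomI)
  have "((\<iota> (base A') \<boxtimes> unt A') \<cdot> Inv M (\<r> (base A'))) \<cdot> ?f
      = (?f \<boxtimes> ?f) \<cdot> (\<iota> (base A) \<boxtimes> unt A) \<cdot> Inv M (\<r> (base A))"
    using Inv_Runit_nat[of ?f "base A" "base A'"] F(6) by (simp add: Ten_merge)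
  moreover have "((unt A' \<boxtimes> \<iota> (base A')) \<cdot> Inv M (\<l> (base A'))) \<cdot> ?f
      = (?f \<boxtimes> ?f) \<cdot> (unt A \<boxtimes> \<iota> (base A)) \<cdot> Inv M (\<l> (base A))"
    using Inv_Lunit_nat[of ?f "base A" "base A'"] F(6) by (simp add: Ten_merge)
  ultimately show ?thesis
    unfolding primitive_target_def Comp_Plus_left[OF q' F(5)] Comp_Plus_right[OF q ff] by simp
qed

section \<open>Restricting braidings and morphisms to the primitive parts\<close>

context
  fixes P :: "('a, 'b) br_bialg \<Rightarrow> 'a" and \<xi> :: "('a, 'b) br_bialg \<Rightarrow> 'b"
  assumes choice: "primitive_choice M P \<xi>"
begin

lemma primitive_equalizer:
  assumes "A \<in> Obj (BrBialg M)"
  shows "is_equalizer M (comul A) (primitive_target M A) (P A) (\<xi> A)"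
    "\<xi> A \<in> Hom M (P A) (base A)" "comul A \<cdot> \<xi> A = primitive_target M A \<cdot> \<xi> A"
    "primitive_target M A \<in> Hom M (base A) (base A \<boxdot> base A)"
    "mono_arr (\<xi> A)" "mono_arr (\<xi> A \<boxtimes> \<xi> A)"
proof -
  show eq: "is_equalizer M (comul A) (primitive_target M A) (P A) (\<xi> A)"
    using choice assms by (simp add: primitive_choice_def)
  show e: "\<xi> A \<in> Hom M (P A) (base A)" "comul A \<cdot> \<xi> A = primitive_target M A \<cdot> \<xi> A"
    "primitive_target M A \<in> Hom M (base A) (base A \<boxdot> base A)"
    using equalizer_Hom[OF eq BrBialg_ObjD(3)[OF assms]] by simp_all
  show "mono_arr (\<xi> A)" "mono_arr (\<xi> A \<boxtimes> \<xi> A)"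
    using equalizer_mono[OF eq] equalizer_cube_mono(1)[OF eq e(1)] by simp_all
qed

text \<open>Existence comes from the sliding of both arrows of the pair, uniqueness from
  \<open>\<xi> A \<boxtimes> \<xi> A\<close> being monic. Together they identify the definite
  description \<open>primitive_braiding\<close> with the restriction found, which is already known
  to be a braiding.\<close>

lemma primitive_braiding_unique:
  assumes A: "A \<in> Obj (BrBialg M)"
  shows "\<exists>!c. c \<in> Hom M (P A \<boxdot> P A) (P A \<boxdot> P A) \<and> (\<xi> A \<boxtimes> \<xi> A) \<cdot> c = braid A \<cdot> (\<xi> A \<boxtimes> \<xi> A)"
    and "braided_object M (P A) (primitive_braiding M P \<xi> A)"
    and "braided_object_morphism M (P A) (primitive_braiding M P \<xi> A) (base A) (braid A) (\<xi> A)"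
proof -
  let ?Q = "\<lambda>c. c \<in> Hom M (P A \<boxdot> P A) (P A \<boxdot> P A) \<and> (\<xi> A \<boxtimes> \<xi> A) \<cdot> c = braid A \<cdot> (\<xi> A \<boxtimes> \<xi> A)"
  note e = primitive_equalizer[OF A]
  note [simp] = HomD[OF e(2)]
  obtain k where k: "?Q k" and br: "braided_object M (P A) k"
    using slides_equalizer_braided[OF e(1) BrBialg_ObjD(3,4,6)[OF A] slides_primitive_target[OF A]]
    by metis
  show ex1: "\<exists>!c. ?Q c"
  proof (rule ex1I[of ?Q, OF k])
    fix c assume "?Q c"
    then show "c = k"
      using k by - (rule mono_arrD[OF e(6), of _ _ "P A \<boxdot> P A"], auto)
  qed
  have "primitive_braiding M P \<xi> A = k"
    unfolding primitive_braiding_def by (rule the1_equality[OF ex1 k])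
  then show "braided_object M (P A) (primitive_braiding M P \<xi> A)"
    "braided_object_morphism M (P A) (primitive_braiding M P \<xi> A) (base A) (braid A) (\<xi> A)"
    using br k e(2) by (simp_all add: braided_object_morphism_def)
qed

text \<open>Both arrows of the primitive pair are natural in the bialgebra, so
  \<open>sarr f \<cdot> \<xi> A\<close> equalizes the pair of \<open>A'\<close> and factors through
  \<open>\<xi> A'\<close>.\<close>

lemma primitive_map_unique:
  assumes f: "f \<in> Hom (BrBialg M) A A'"
  shows "\<exists>!h. h \<in> Hom M (P A) (P A') \<and> \<xi> A' \<cdot> h = sarr f \<cdot> \<xi> A"
    and "primitive_map M P \<xi> f \<in> Hom M (P A) (P A')"
    and "\<xi> A' \<cdot> primitive_map M P \<xi> f = sarr f \<cdot> \<xi> A"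
proof -
  let ?Q = "\<lambda>h. h \<in> Hom M (P A) (P A') \<and> \<xi> A' \<cdot> h = sarr f \<cdot> \<xi> A"
  note F = BrBialg_HomD[OF f]
  note e = primitive_equalizer[OF F(1)] and e' = primitive_equalizer[OF F(2)]
  note d = BrBialg_ObjD(3)[OF F(1)] and d' = BrBialg_ObjD(3)[OF F(2)]
  note [simp] = HomD[OF e(2)] HomD[OF e'(2)] HomD[OF e(4)] HomD[OF e'(4)] HomD[OF F(5)]
    HomD[OF d] HomD[OF d']
  have "comul A' \<cdot> sarr f \<cdot> \<xi> A = (sarr f \<boxtimes> sarr f) \<cdot> comul A \<cdot> \<xi> A"
    using Comp_reduce[OF F(7), of "\<xi> A"] by simp
  also have "\<dots> = primitive_target M A' \<cdot> sarr f \<cdot> \<xi> A"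
    using Comp_reduce[OF primitive_target_natural[OF f], of "\<xi> A"] e(3) by simp
  finally obtain h where h: "?Q h"
    using equalizer_factor[OF e'(1) d' Comp_in_Hom[OF e(2) F(5)]] by metis
  show ex1: "\<exists>!h. ?Q h"
  proof (rule ex1I[of ?Q, OF h])
    fix h' assume "?Q h'"
    then show "h' = h"
      using h by - (rule mono_arrD[OF e'(5), of _ _ "P A"], auto)
  qed
  have "primitive_map M P \<xi> f = h"
    unfolding primitive_map_def F(3,4) by (rule the1_equality[OF ex1 h])
  then show "primitive_map M P \<xi> f \<in> Hom M (P A) (P A')" "\<xi> A' \<cdot> primitive_map M P \<xi> f = sarr f \<cdot> \<xi> A"
    using h by simp_all
qed

text \<open>Reduces the functor laws to checking the defining equation for the expected
  value.\<close>

lemma primitive_map_eqI: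
  assumes f: "f \<in> Hom (BrBialg M) A A'" and "h \<in> Hom M (P A) (P A')" "\<xi> A' \<cdot> h = sarr f \<cdot> \<xi> A"
  shows "primitive_map M P \<xi> f = h"
  using primitive_map_unique[OF f] assms(2,3) by blast

text \<open>After composition with the monic \<open>\<xi> A' \<boxtimes> \<xi> A'\<close>, both
  sides equal \<open>(sarr f \<boxtimes> sarr f) \<cdot> braid A \<cdot> (\<xi> A \<boxtimes> \<xi>
  A)\<close>.\<close>

lemma primitive_map_braided:
  assumes f: "f \<in> Hom (BrBialg M) A A'"
  shows "braided_object_morphism M (P A) (primitive_braiding M P \<xi> A)
    (P A') (primitive_braiding M P \<xi> A') (primitive_map M P \<xi> f)"
proof -
  let ?h = "primitive_map M P \<xi> f" and ?k = "primitive_braiding M P \<xi> A"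
    and ?k' = "primitive_braiding M P \<xi> A'"
  note F = BrBialg_HomD[OF f]
  note e = primitive_equalizer[OF F(1)] and e' = primitive_equalizer[OF F(2)]
  note h = primitive_map_unique(2,3)[OF f]
  have k: "?k \<in> Hom M (P A \<boxdot> P A) (P A \<boxdot> P A)" and k': "?k' \<in> Hom M (P A' \<boxdot> P A') (P A' \<boxdot> P A')"
    and ek: "braid A \<cdot> (\<xi> A \<boxtimes> \<xi> A) = (\<xi> A \<boxtimes> \<xi> A) \<cdot> ?k"
    and ek': "braid A' \<cdot> (\<xi> A' \<boxtimes> \<xi> A') = (\<xi> A' \<boxtimes> \<xi> A') \<cdot> ?k'"
    using primitive_braiding_unique(2,3)[OF F(1)] primitive_braiding_unique(2,3)[OF F(2)]
    by (auto simp: braided_object_def braided_object_morphism_def)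
  have fc: "braid A' \<cdot> (sarr f \<boxtimes> sarr f) = (sarr f \<boxtimes> sarr f) \<cdot> braid A"
    using F(8) by (simp add: braided_object_morphism_def)
  note [simp] = HomD[OF e(2)] HomD[OF e'(2)] HomD[OF F(5)] HomD[OF k] HomD[OF k'] HomD[OF h(1)]
    HomD[OF BrBialg_ObjD(5)[OF F(1)]] HomD[OF BrBialg_ObjD(5)[OF F(2)]]
  have hh: "(\<xi> A' \<boxtimes> \<xi> A') \<cdot> (?h \<boxtimes> ?h) = (sarr f \<boxtimes> sarr f) \<cdot> (\<xi> A \<boxtimes> \<xi> A)"
    by (simp add: Ten_merge h(2))
  have "(\<xi> A' \<boxtimes> \<xi> A') \<cdot> ?k' \<cdot> (?h \<boxtimes> ?h) = braid A' \<cdot> (\<xi> A' \<boxtimes> \<xi> A') \<cdot> (?h \<boxtimes> ?h)"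
    using Comp_reduce[OF ek', of "?h \<boxtimes> ?h"] by simp
  also have "\<dots> = (sarr f \<boxtimes> sarr f) \<cdot> braid A \<cdot> (\<xi> A \<boxtimes> \<xi> A)"
    using Comp_reduce[OF fc, of "\<xi> A \<boxtimes> \<xi> A"] by (simp add: hh)
  also have "\<dots> = (\<xi> A' \<boxtimes> \<xi> A') \<cdot> (?h \<boxtimes> ?h) \<cdot> ?k"
    using Comp_reduce[OF hh, of ?k] by (simp add: ek)
  finally have "?k' \<cdot> (?h \<boxtimes> ?h) = (?h \<boxtimes> ?h) \<cdot> ?k"
    by (rule mono_arrD[OF e'(6), of _ _ "P A \<boxdot> P A"]) (auto intro: HomI)
  then show ?thesis
    using h(1) by (simp add: braided_object_morphism_def)
qed

section \<open>Functoriality and naturality\<close>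

lemma P_Br_functor: "cat_functor (BrBialg M) (Br M) (P_Br M P \<xi>)"
proof (intro cat_functor.intro category_BrBialg category_Br cat_functor_axioms.intro)
  interpret B: category "BrBialg M"
    by (rule category_BrBialg)
  fix A A' A'' f g
  show obj: "on_obj (P_Br M P \<xi>) A \<in> Obj (Br M)" if "A \<in> Obj (BrBialg M)" for A
    using primitive_braiding_unique(2)[OF that]
    by (simp add: P_Br_def P_Br_obj_def Br_def structured_category_def)
  show "on_arr (P_Br M P \<xi>) f \<in> Hom (Br M) (on_obj (P_Br M P \<xi>) A) (on_obj (P_Br M P \<xi>) A')"
    if f: "f \<in> Hom (BrBialg M) A A'"
    using obj[OF BrBialg_HomD(1)[OF f]] obj[OF BrBialg_HomD(2)[OF f]] primitive_map_braided[OF f]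
    by (simp add: P_Br_def P_Br_obj_def Br_def structured_category_def Hom_def br_obj_mor_def
        BrBialg_HomD(3,4)[OF f])
  show "on_arr (P_Br M P \<xi>) (\<iota>\<^bsub>BrBialg M\<^esub> A) = \<iota>\<^bsub>Br M\<^esub> (on_obj (P_Br M P \<xi>) A)"
    if A: "A \<in> Obj (BrBialg M)"
  proof -
    have id: "\<iota>\<^bsub>BrBialg M\<^esub> A = SArr A (\<iota> (base A)) A"
      by (simp add: BrBialg_def structured_category_def)
    note [simp] = HomD[OF primitive_equalizer(2)[OF A]]
    have "primitive_map M P \<xi> (\<iota>\<^bsub>BrBialg M\<^esub> A) = \<iota> (P A)"
      by (rule primitive_map_eqI[OF B.Ident_in_Hom[OF A]]) (auto simp: id intro: Ident_in_Hom)
    then show ?thesis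
      by (simp add: P_Br_def P_Br_obj_def id) (simp add: Br_def structured_category_def)
  qed
  show "on_arr (P_Br M P \<xi>) (g \<cdot>\<^bsub>BrBialg M\<^esub> f)
      = on_arr (P_Br M P \<xi>) g \<cdot>\<^bsub>Br M\<^esub> on_arr (P_Br M P \<xi>) f"
    if f: "f \<in> Hom (BrBialg M) A A'" and g: "g \<in> Hom (BrBialg M) A' A''"
  proof -
    note F = BrBialg_HomD[OF f] and G = BrBialg_HomD[OF g]
    note hf = primitive_map_unique(2,3)[OF f] and hg = primitive_map_unique(2,3)[OF g]
    have comp: "g \<cdot>\<^bsub>BrBialg M\<^esub> f = SArr A (sarr g \<cdot> sarr f) A''"
      by (simp add: BrBialg_def structured_category_def F G)
    note [simp] = HomD[OF F(5)] HomD[OF G(5)] HomD[OF hf(1)] HomD[OF hg(1)]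
      HomD[OF primitive_equalizer(2)[OF F(1)]] HomD[OF primitive_equalizer(2)[OF F(2)]]
      HomD[OF primitive_equalizer(2)[OF G(2)]]
    \<comment> \<open>Pasting the defining squares of \<open>f\<close> and \<open>g\<close> shows
      that the composite satisfies the equation that characterizes the left side.\<close>
    have "primitive_map M P \<xi> (g \<cdot>\<^bsub>BrBialg M\<^esub> f) = primitive_map M P \<xi> g \<cdot> primitive_map M P \<xi> f"
      by (rule primitive_map_eqI[OF B.Comp_in_Hom[OF f g] Comp_in_Hom[OF hf(1) hg(1)]])
         (simp add: comp hf(2) Comp_reduce[OF hg(2)])
    then show ?thesis
      by (simp add: P_Br_def comp F(3,4) G(3,4)) (simp add: Br_def structured_category_def)
  qed
qed

text \<open>The component at \<open>A\<close> is \<open>\<xi> A\<close> tagged with its source and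
  target in \<open>Br M\<close>. The forgetful functors keep the underlying arrow, so naturality is
  the defining equation of \<open>primitive_map\<close>.\<close>

lemma primitive_natural_transformation:
  "natural_transformation (BrBialg M) (Br M) (P_Br M P \<xi>) (functor_comp Omega_Br mho_Br)
     (\<lambda>A. SArr (P_Br_obj M P \<xi> A) (\<xi> A) (on_obj (functor_comp Omega_Br mho_Br) A))"
proof (intro natural_transformation.intro natural_transformation_axioms.intro P_Br_functor)
  interpret U: cat_functor "BrBialg M" "BrAlg M" mho_Br
    by (rule mho_Br_functor)
  interpret W: cat_functor "BrAlg M" "Br M" Omega_Br
    by (rule Omega_Br_functor)
  have arr: "on_arr Omega_Br (on_arr mho_Br f)
      = SArr (on_obj Omega_Br (on_obj mho_Br A)) (sarr f) (on_obj Omega_Br (on_obj mho_Br A'))"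
    if "f \<in> Hom (BrBialg M) A A'" for f A A'
    using BrBialg_HomD(3,4)[OF that] by (simp add: mho_Br_def Omega_Br_def forgetful_functor_def)
  show "cat_functor (BrBialg M) (Br M) (functor_comp Omega_Br mho_Br)"
  proof (intro cat_functor.intro category_BrBialg category_Br cat_functor_axioms.intro)
  qed (auto simp: functor_comp_def intro: U.on_obj_in_Obj W.on_obj_in_Obj U.on_arr_in_Hom
      W.on_arr_in_Hom simp: U.on_arr_Ident W.on_arr_Ident U.on_obj_in_Obj
      U.on_arr_Comp W.on_arr_Comp[OF U.on_arr_in_Hom U.on_arr_in_Hom])
  fix A A' f
  show "SArr (P_Br_obj M P \<xi> A) (\<xi> A) (on_obj (functor_comp Omega_Br mho_Br) A)
      \<in> Hom (Br M) (on_obj (P_Br M P \<xi>) A) (on_obj (functor_comp Omega_Br mho_Br) A)"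
    if A: "A \<in> Obj (BrBialg M)"
    using primitive_braiding_unique(2,3)[OF A] BrBialg_ObjD(4)[OF A]
    by (simp add: Hom_def Br_def structured_category_def P_Br_def P_Br_obj_def functor_comp_def
        mho_Br_def Omega_Br_def forgetful_functor_def br_obj.truncate_def br_alg.truncate_def
        br_obj_mor_def)
  show "SArr (P_Br_obj M P \<xi> A') (\<xi> A') (on_obj (functor_comp Omega_Br mho_Br) A')
        \<cdot>\<^bsub>Br M\<^esub> on_arr (P_Br M P \<xi>) f
      = on_arr (functor_comp Omega_Br mho_Br) f
        \<cdot>\<^bsub>Br M\<^esub> SArr (P_Br_obj M P \<xi> A) (\<xi> A) (on_obj (functor_comp Omega_Br mho_Br) A)"
    if f: "f \<in> Hom (BrBialg M) A A'"
    using primitive_map_unique(3)[OF f] BrBialg_HomD(3,4)[OF f]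
    by (simp add: functor_comp_def arr[OF f] P_Br_def) (simp add: Br_def structured_category_def)
qed

end

end

theorem lemma3p3:
  fixes M :: "('o, 'm) preadditive_monoidal_category"
    and P :: "('o, 'm) br_bialg \<Rightarrow> 'o"
    and \<xi> :: "('o, 'm) br_bialg \<Rightarrow> 'm"
  assumes "preadditive_monoidal_category M"
    and "has_equalizers M"
    and "\<And>X. X \<in> Obj M \<Longrightarrow> additive_functor M M (left_tensor_functor M X)"
    and "\<And>X. X \<in> Obj M \<Longrightarrow> additive_functor M M (right_tensor_functor M X)"
    and "\<And>X. X \<in> Obj M \<Longrightarrow> preserves_equalizers M M (left_tensor_functor M X)"
    and "\<And>X. X \<in> Obj M \<Longrightarrow> preserves_equalizers M M (right_tensor_functor M X)"
    and "primitive_choice M P \<xi>"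
  shows
    "(\<forall>A\<in>Obj (BrBialg M).
        (\<exists>!c. c \<in> Hom M (P A \<boxdot>\<^bsub>M\<^esub> P A) (P A \<boxdot>\<^bsub>M\<^esub> P A) \<and>
           (\<xi> A \<boxtimes>\<^bsub>M\<^esub> \<xi> A) \<cdot>\<^bsub>M\<^esub> c = braid A \<cdot>\<^bsub>M\<^esub> (\<xi> A \<boxtimes>\<^bsub>M\<^esub> \<xi> A)) \<and>
        braided_object M (P A) (primitive_braiding M P \<xi> A) \<and>
        braided_object_morphism M (P A) (primitive_braiding M P \<xi> A) (base A) (braid A) (\<xi> A)) \<and>
     (\<forall>A A' f. f \<in> Hom (BrBialg M) A A' \<longrightarrow>
        (\<exists>!h. h \<in> Hom M (P A) (P A') \<and> \<xi> A' \<cdot>\<^bsub>M\<^esub> h = sarr f \<cdot>\<^bsub>M\<^esub> \<xi> A) \<and>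
        braided_object_morphism M (P A) (primitive_braiding M P \<xi> A)
          (P A') (primitive_braiding M P \<xi> A') (primitive_map M P \<xi> f)) \<and>
     cat_functor (BrBialg M) (Br M) (P_Br M P \<xi>) \<and>
     (\<forall>A A' f. f \<in> Hom (BrBialg M) A A' \<longrightarrow>
        \<xi> A' \<cdot>\<^bsub>M\<^esub> sarr (on_arr (P_Br M P \<xi>) f)
          = sarr (on_arr Omega_Br (on_arr mho_Br f)) \<cdot>\<^bsub>M\<^esub> \<xi> A) \<and>
     natural_transformation (BrBialg M) (Br M) (P_Br M P \<xi>) (functor_comp Omega_Br mho_Br)
       (\<lambda>A. SArr (P_Br_obj M P \<xi> A) (\<xi> A) (on_obj (functor_comp Omega_Br mho_Br) A))"
proof -
  interpret preadditive_monoidal_category M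
    by (rule assms(1))
  \<comment> \<open>The four assumptions on the tensor functors are the axioms that this locale
    adds.\<close>
  interpret exact_tensor_category M
    by unfold_locales (fact assms)+
  note choice = assms(7)
  have map: "\<xi> A' \<cdot>\<^bsub>M\<^esub> sarr (on_arr (P_Br M P \<xi>) f)
      = sarr (on_arr Omega_Br (on_arr mho_Br f)) \<cdot>\<^bsub>M\<^esub> \<xi> A" if "f \<in> Hom (BrBialg M) A A'" for A A' f
    using primitive_map_unique(3)[OF choice that]
    by (simp add: P_Br_def mho_Br_def Omega_Br_def forgetful_functor_def)
  show ?thesis
    by (intro conjI ballI allI impI primitive_braiding_unique[OF choice]
        primitive_map_unique(1)[OF choice] primitive_map_braided[OF choice] P_Br_functor[OF choice]
        map primitive_natural_transformation[OF choice])
qed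

end
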